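(* Let $\Sigma=\{1,\dots,s\}$, let $q=(q_1,\dots,q_s)$ be a probability vector on $\Sigma$, and let $A:\Sigma\to\mathrm{SL}_2(\mathbb{R})$ be a strongly irreducible random cocycle over the Bernoulli shift determined by $q$, such that $L(A)=0$. Then there exists $C=C(A)<\infty$ such that for any other cocycle $B:\Sigma\to\mathrm{SL}_2(\mathbb{R})$, $$|L(A)-L(B)|\le C\,\|A-B\|_\infty .$$
   Context: Let $T$ be the two-sided full shift on $X=\Sigma^{\mathbb{Z}}$ with the product measure $\mathbb{P}_q=q^{\mathbb{Z}}$ (the Bernoulli measure, which is fixed). A function $A:\Sigma\to\mathrm{SL}_2(\mathbb{R})$ (i.e. a list $A_1,\dots,A_s$ of matrices) defines the random cocycle $A(x)=A_{x_0}$, $x=\{x_n\}_{n\in\mathbb{Z}}\in X$, with iterates $A^{(n)}(x)=A(T^{n-1}x)\cdots A(Tx)A(x)$ and Lyapunov exponent $L(A)=\lim_{n\to\infty}\frac1n\log\|A^{(n)}(x)\|$ ($\mathbb{P}_q$-almost sure limit). The cocycle $A$ is strongly irreducible if there is no finite nonempty subset $L$ of the projective line $\mathbb{P}(\mathbb{R}^2)$ such that $A(x)L=L$ for all $x\in\Sigma$. The norm is $\|A\|_\infty:=\max_{x\in\Sigma}\|A(x)\|$, where $\|\cdot\|$ is the canonical operator norm on $2\times2$ real matrices.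
   Formalization: Strong irreducibility is required for the symbols of positive probability only, which is the same when all q_i > 0; if some q_i = 0 the literal claim fails, e.g. q = (1,0), A_1 = [[1,1],[0,1]], A_2 an irrational rotation. *)

theory Defs
  imports "HOL-Probability.Probability"
begin

(* The alphabet is a finite type 's, a probability vector on it is a pmf, and a
   random cocycle is a function 's => real^2^2 with values in SL2. *)

definition SL2 :: "(real^2^2) set" where
  "SL2 = {M. det M = 1}"

(* The built-in norm on real^2^2 is the Frobenius norm, not the operator norm. *)
definition op_norm :: "real^2^2 \<Rightarrow> real" where
  "op_norm M = onorm (\<lambda>v. M *v v)"

definition sup_norm :: "('s::finite \<Rightarrow> real^2^2) \<Rightarrow> real" where
  "sup_norm A = (MAX i. op_norm (A i))"

definition bernoulli :: "'s pmf \<Rightarrow> (int \<Rightarrow> 's) measure" where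
  "bernoulli q = (\<Pi>\<^sub>M n\<in>(UNIV :: int set). measure_pmf q)"

definition shift :: "(int \<Rightarrow> 's) \<Rightarrow> (int \<Rightarrow> 's)" where
  "shift x = (\<lambda>n. x (n + 1))"

primrec cocycle_iterate :: "('s \<Rightarrow> real^2^2) \<Rightarrow> nat \<Rightarrow> (int \<Rightarrow> 's) \<Rightarrow> real^2^2" where
  "cocycle_iterate A 0 x = mat 1"
| "cocycle_iterate A (Suc n) x = A ((shift ^^ n) x 0) ** cocycle_iterate A n x"

definition lyapunov_exponent :: "'s pmf \<Rightarrow> ('s \<Rightarrow> real^2^2) \<Rightarrow> real" where
  "lyapunov_exponent q A =
     (THE c. AE x in bernoulli q.
        (\<lambda>n. ln (op_norm (cocycle_iterate A n x)) / real n) \<longlonglongrightarrow> c)"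

(* Points of the projective line are the lines through the origin; an invertible
   matrix acts on them by taking images. *)
definition projective_line :: "(real^2) set set" where
  "projective_line = {V. subspace V \<and> dim V = 1}"

definition proj_action :: "real^2^2 \<Rightarrow> (real^2) set \<Rightarrow> (real^2) set" where
  "proj_action M V = (\<lambda>v. M *v v) ` V"

(* Strong irreducibility over the alphabet S. For the Bernoulli measure of q, the
   alphabet is the set of symbols of positive probability (all of 's if q has no
   zero entries); symbols of probability zero do not influence the exponent. *)
definition strongly_irreducible :: "'s set \<Rightarrow> ('s \<Rightarrow> real^2^2) \<Rightarrow> bool" where
  "strongly_irreducible S A \<longleftrightarrow>
     \<not> (\<exists>L. L \<subseteq> projective_line \<and> finite L \<and> L \<noteq> {} \<and>
          (\<forall>i\<in>S. proj_action (A i) ` L = L))"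

end

theory Submission
  imports Defs
begin

text \<open>A vanishing exponent together with strong irreducibility forces the semigroup generated by the
  matrices \<open>A i\<close> to be bounded, say by \<open>K\<close> (Furstenberg). Expanding a product of the perturbed matrices
  \<open>B i = A i + (B i - A i)\<close> then gives norms at most \<open>K * (1 + K * \<delta>) ^ n\<close> with
  \<open>\<delta> = sup_norm (A - B)\<close>, so that \<open>0 \<le> L(B) \<le> K * \<delta>\<close>.

  For boundedness, consider the Markov operator of the random walk on \<open>L\<^sup>2\<close> of the plane, on which
  matrices of determinant one act by isometries. If the semigroup is unbounded, five of its elements
  play ping-pong with pairwise disjoint cones, and almost orthogonality shows that some power of the
  lazy Markov operator is a strict contraction. If the exponent is zero, a walk of length \<open>n\<close>
  distorts by at most \<open>exp (\<epsilon> * n)\<close> with probability at least 1/2; then the iterates of the indicator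
  of the unit disc decay arbitrarily slowly, a contradiction.

  Since the exponent is defined by a definite description, the almost sure convergence to a constant
  (Furstenberg and Kesten) is needed as well.\<close>

section \<open>Subadditive sequences over measure preserving maps\<close>

text \<open>The estimate is linear in \<delta> because \<open>K\<close> is uniform: each stretch of
  unperturbed letters between two perturbed ones costs a single factor \<open>K\<close>, whatever
  its length, so \<open>K\<close> enters the exponential rate only together with \<delta>. The lower
  bound 0 holds because matrices of determinant one have operator norm at least one.

  Working on the plane instead of the projective line avoids stationary measures, as Lebesgue
  measure is invariant under all letters at once. Distortion then shows up in areas: a point of the
  disc of radius \<open>exp (- \<epsilon> * n)\<close> is carried into the unit disc with
  probability at least 1/2, so the squared norm of the iterate is at least a constant times
  \<open>exp (- 2 * \<epsilon> * n)\<close>. Contraction forces a fixed exponential rate of decay,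
  and a small enough \<epsilon> contradicts it.\<close>

locale measure_preserving = prob_space M for M :: "'a measure" +
  fixes T :: "'a \<Rightarrow> 'a"
  assumes T_meas [measurable]: "T \<in> measurable M M"
    and T_pres: "distr M M T = M"
begin

lemma T_funpow_meas [measurable]: "(T ^^ n) \<in> measurable M M"
  by (induction n) auto

lemma T_funpow_pres: "distr M M (T ^^ n) = M"
proof (induction n)
  case 0
  then show ?case by (simp add: distr_id id_def)
next
  case (Suc n)
  have "distr M M (T ^^ Suc n) = distr (distr M M (T ^^ n)) M T"
    by (subst distr_distr) auto
  then show ?case by (simp only: Suc T_pres)
qed

lemma expectation_funpow:
  assumes [measurable]: "f \<in> borel_measurable M"
  shows "expectation (\<lambda>x. f ((T ^^ n) x)) = (expectation f :: real)"
proof -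
  have "expectation f = integral\<^sup>L (distr M M (T ^^ n)) f" by (simp add: T_funpow_pres)
  also have "\<dots> = expectation (\<lambda>x. f ((T ^^ n) x))" by (rule integral_distr) auto
  finally show ?thesis by simp
qed

lemma T_funpow_space: "x \<in> space M \<Longrightarrow> (T ^^ n) x \<in> space M"
  using measurable_space[OF T_funpow_meas] by blast

text \<open>The orbit of \<open>x\<close> is cut into stretches along which the average of \<open>f\<close> is at most \<open>c\<close>;
  they have length at most \<open>N\<close> outside a set \<open>D\<close> of small measure, and every visit to \<open>D\<close>
  costs one step with the trivial bound (Katznelson and Weiss).\<close>

lemma subadditive_expectation_le:
  fixes f :: "nat \<Rightarrow> 'a \<Rightarrow> real"
  assumes meas [measurable]: "\<And>n. f n \<in> borel_measurable M"
    and bound: "\<And>n x. x \<in> space M \<Longrightarrow> \<bar>f n x\<bar> \<le> K * real n"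
    and sub: "\<And>n k x. x \<in> space M \<Longrightarrow> f (n + k) x \<le> f n x + f k ((T ^^ n) x)"
    and AE: "AE x in M. \<exists>n\<ge>1. f n x \<le> c * real n"
    and "\<delta> > 0"
  shows "\<forall>\<^sub>F n in sequentially. expectation (f n) \<le> (c + \<delta>) * real n"
proof -
  define h where "h n x = f n x - c * real n" for n x
  define D where "D N = {x \<in> space M. \<forall>n\<in>{1..N}. h n x > 0}" for N
  define K' where "K' = \<bar>K\<bar> + \<bar>c\<bar> + 1"
  have K': "K' > 0" by (simp add: K'_def)
  have h_meas [measurable]: "h n \<in> borel_measurable M" for n unfolding h_def by measurable
  have D_meas [measurable]: "D N \<in> sets M" for N unfolding D_def by measurable
  have h_bound: "h n x \<le> K' * real n" if "x \<in> space M" for n x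
  proof -
    have "h n x \<le> (K - c) * real n"
      using bound[OF that, of n] by (simp add: h_def algebra_simps abs_le_iff)
    also have "\<dots> \<le> K' * real n" by (intro mult_right_mono) (auto simp: K'_def)
    finally show ?thesis .
  qed
  have h_sub: "h (n + k) x \<le> h n x + h k ((T ^^ n) x)" if "x \<in> space M" for n k x
    using sub[OF that, of n k] by (simp add: h_def algebra_simps)
  \<comment> \<open>The summand \<open>real N\<close> pays for the end of the orbit: with at most
    \<open>N\<close> steps left a good stretch could overshoot, so the trivial bound is used
    there.\<close>
  have key: "h n x \<le> K' * ((\<Sum>j<n. indicator (D N) ((T ^^ j) x)) + real N)"
    if "x \<in> space M" for n x N
    using that
  proof (induction n arbitrary: x rule: less_induct)
    case (less n)
    let ?I = "\<lambda>n x. \<Sum>j<n. indicator (D N) ((T ^^ j) x) :: real"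
    have shift: "?I (k + l) x = ?I k x + ?I l ((T ^^ k) x)" for k l
    proof (induction l)
      case (Suc l)
      have "(T ^^ (k + l)) x = (T ^^ l) ((T ^^ k) x)"
        by (metis add.commute comp_apply funpow_add)
      then show ?case using Suc by simp
    qed simp
    have nonneg: "?I k y \<ge> 0" for k y by (intro sum_nonneg) auto
    show ?case
    proof (cases "n \<le> N")
      case True
      have "h n x \<le> K' * real n" using h_bound less.prems by auto
      also have "\<dots> \<le> K' * (?I n x + real N)" using True K' nonneg[of x n] by (intro mult_left_mono) auto
      finally show ?thesis .
    next
      case n: False
      obtain k where k: "k \<ge> 1" "k \<le> n" "h k x \<le> K' * ?I k x"
      proof (cases "x \<in> D N")
        case True
        have "h 1 x \<le> K' * ?I 1 x" using h_bound[OF less.prems, of 1] True by simp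
        then show ?thesis using that[of 1] n by simp
      next
        case False
        then obtain k where "k \<in> {1..N}" "h k x \<le> 0"
          using less.prems unfolding D_def by force
        moreover have "0 \<le> K' * ?I k x" using nonneg K' by (intro mult_nonneg_nonneg) auto
        ultimately show ?thesis using that[of k] n by simp
      qed
      have "h n x \<le> h k x + h (n - k) ((T ^^ k) x)"
        using h_sub[OF less.prems, of k "n - k"] k by simp
      also have "h (n - k) ((T ^^ k) x) \<le> K' * (?I (n - k) ((T ^^ k) x) + real N)"
        using k n less.prems by (intro less.IH T_funpow_space) auto
      also have "h k x \<le> K' * ?I k x" by (rule k)
      also have "K' * ?I k x + K' * (?I (n - k) ((T ^^ k) x) + real N)
          = K' * (?I (k + (n - k)) x + real N)"
        by (subst shift) (simp add: algebra_simps)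
      finally show ?thesis using k by simp
    qed
  qed
  have int: "integrable M (f n)" for n
    using bound by (intro integrable_const_bound[where B = "K * real n"]) auto
  have E: "expectation (f n) \<le> c * real n + K' * (prob (D N) * real n + real N)" for n N
  proof -
    have ind: "integrable M (\<lambda>x. indicator (D N) ((T ^^ j) x) :: real)" for j
      by (intro integrable_const_bound[where B = 1]) (auto simp: indicator_def)
    have "expectation (h n) \<le> expectation (\<lambda>x. K' * ((\<Sum>j<n. indicator (D N) ((T ^^ j) x)) + real N))"
    proof (rule integral_mono)
      show "integrable M (h n)" unfolding h_def using int by auto
      show "integrable M (\<lambda>x. K' * ((\<Sum>j<n. indicator (D N) ((T ^^ j) x)) + real N))"
        using ind by auto
    qed (use key in auto)
    also have "\<dots> = K' * ((\<Sum>j<n. expectation (\<lambda>x. indicator (D N) ((T ^^ j) x))) + real N)"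
      using ind by (simp add: Bochner_Integration.integral_sum Bochner_Integration.integrable_sum prob_space)
    also have "\<dots> = K' * ((\<Sum>j<n. expectation (indicator (D N))) + real N)"
      by (subst expectation_funpow) auto
    also have "expectation (h n) = expectation (f n) - c * real n"
      unfolding h_def using int by (simp add: prob_space)
    finally show ?thesis by (simp add: algebra_simps)
  qed
  have D_lim: "(\<lambda>N. prob (D N)) \<longlonglongrightarrow> 0"
  proof -
    have "(\<lambda>N. prob (D N)) \<longlonglongrightarrow> prob (\<Inter>N. D N)"
      by (rule finite_Lim_measure_decseq) (auto simp: decseq_def D_def)
    moreover have "AE x in M. x \<notin> (\<Inter>N. D N)"
      using AE
    proof eventually_elim
      case (elim x)
      then obtain n where "n \<ge> 1" "h n x \<le> 0" by (auto simp: h_def)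
      then have "x \<notin> D n" by (force simp: D_def)
      then show ?case by blast
    qed
    then have "prob (\<Inter>N. D N) = 0" by (intro prob_eq_0[THEN iffD2]) auto
    ultimately show ?thesis by simp
  qed
  then have "\<forall>\<^sub>F N in sequentially. prob (D N) < \<delta> / (2 * K')"
    using K' \<open>\<delta> > 0\<close> by (intro order_tendstoD) auto
  then obtain N where N: "prob (D N) < \<delta> / (2 * K')" by (auto simp: eventually_sequentially)
  have "\<forall>\<^sub>F n in sequentially. 2 * K' * real N / \<delta> \<le> real n"
    using filterlim_real_sequentially by (auto simp: filterlim_at_top)
  then show ?thesis
  proof eventually_elim
    case (elim n)
    have "K' * (prob (D N) * real n) \<le> \<delta> / 2 * real n"
    proof -
      have "K' * prob (D N) \<le> \<delta> / 2" using N K' by (simp add: field_simps)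
      then have "K' * prob (D N) * real n \<le> \<delta> / 2 * real n" by (rule mult_right_mono) simp
      then show ?thesis by (simp add: algebra_simps)
    qed
    moreover have "K' * real N \<le> \<delta> / 2 * real n"
      using elim \<open>\<delta> > 0\<close> by (simp add: field_simps)
    ultimately show ?case using E[of n N] by (simp add: algebra_simps)
  qed
qed

text \<open>The lower limit of \<open>f n x / n\<close> is invariant under \<open>T\<close>, because
  \<open>f n\<close> moves by at most \<open>C\<close>; so the set where it lies below some
  \<open>c'\<close> strictly between \<open>c\<close> and \<open>L\<close> has probability 0 or 1.
  If it had probability 1, \<open>subadditive_expectation_le\<close> would push the expectations
  below \<open>L * n\<close>. Applied to negated additive sums, the lemma also serves for upper
  bounds.\<close>

lemma subadditive_liminf_ge:
  fixes f :: "nat \<Rightarrow> 'a \<Rightarrow> real"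
  assumes zero_one: "\<And>G. G \<in> sets M \<Longrightarrow> (\<And>x. x \<in> space M \<Longrightarrow> T x \<in> G \<longleftrightarrow> x \<in> G) \<Longrightarrow> prob G = 0 \<or> prob G = 1"
    and meas [measurable]: "\<And>n. f n \<in> borel_measurable M"
    and bound: "\<And>n x. x \<in> space M \<Longrightarrow> \<bar>f n x\<bar> \<le> K * real n"
    and sub: "\<And>n k x. x \<in> space M \<Longrightarrow> f (n + k) x \<le> f n x + f k ((T ^^ n) x)"
    and shift: "\<And>n x. x \<in> space M \<Longrightarrow> \<bar>f n (T x) - f n x\<bar> \<le> C"
    and L: "\<And>n. n \<ge> 1 \<Longrightarrow> L * real n \<le> expectation (f n)"
    and "c < L"
  shows "AE x in M. \<forall>\<^sub>F n in sequentially. c * real n \<le> f n x"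
proof -
  define g where "g x = liminf (\<lambda>n. ereal (f n x / real n))" for x
  have g_meas [measurable]: "g \<in> borel_measurable M" unfolding g_def by measurable
  have g_inv: "g (T x) = g x" if x: "x \<in> space M" for x
  proof -
    have lim: "(\<lambda>n. ereal ((f n (T x) - f n x) / real n)) \<longlonglongrightarrow> 0"
    proof -
      have "(\<lambda>n. (f n (T x) - f n x) / real n) \<longlonglongrightarrow> 0"
      proof (rule Lim_null_comparison)
        show "\<forall>\<^sub>F n in sequentially. norm ((f n (T x) - f n x) / real n) \<le> C / real n"
          using shift[OF x] by (auto intro!: always_eventually divide_right_mono)
        show "(\<lambda>n. C / real n) \<longlonglongrightarrow> 0" by (rule lim_const_over_n)
      qed
      then show ?thesis by (simp add: zero_ereal_def)
    qed
    have "g (T x) = liminf (\<lambda>n. ereal ((f n (T x) - f n x) / real n) + ereal (f n x / real n))"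
      unfolding g_def by (simp add: diff_divide_distrib)
    also have "\<dots> = 0 + g x" unfolding g_def by (rule ereal_liminf_lim_add[OF lim]) simp
    finally show ?thesis by simp
  qed
  obtain c' where c': "c < c'" "c' < L" using dense \<open>c < L\<close> by blast
  define G where "G = {x \<in> space M. g x < ereal c'}"
  have [measurable]: "G \<in> sets M" unfolding G_def by measurable
  have "prob G = 0 \<or> prob G = 1"
    by (rule zero_one) (auto simp: G_def g_inv measurable_space[OF T_meas])
  moreover have "prob G \<noteq> 1"
  proof
    assume "prob G = 1"
    then have "AE x in M. x \<in> G" by (intro prob_eq_1[THEN iffD1]) auto
    then have "AE x in M. \<exists>n\<ge>1. f n x \<le> c' * real n"
    proof eventually_elim
      case (elim x)
      have "\<exists>\<^sub>F n in sequentially. ereal (f n x / real n) < ereal c'"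
      proof (rule ccontr)
        assume "\<not> ?thesis"
        then have "\<forall>\<^sub>F n in sequentially. ereal c' \<le> ereal (f n x / real n)"
          by (simp add: not_frequently not_less)
        from Liminf_bounded[OF this] show False using elim by (auto simp: G_def g_def dest: leD)
      qed
      then have "\<exists>\<^sub>F n in sequentially. f n x / real n < c' \<and> n \<ge> 1"
        using eventually_ge_at_top[of 1] by (simp add: frequently_eventually_frequently)
      then obtain n where "f n x / real n < c'" "n \<ge> 1" by (auto dest: frequently_ex)
      then show ?case by (intro exI[of _ n]) (auto simp: field_simps)
    qed
    then have "\<forall>\<^sub>F n in sequentially. expectation (f n) \<le> (c' + (L - c') / 2) * real n"
      using c' by (intro subadditive_expectation_le[OF meas bound sub]) auto
    then have "\<forall>\<^sub>F n::nat in sequentially. False"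
      using eventually_ge_at_top[of 1]
    proof eventually_elim
      case (elim n)
      then have "L * real n \<le> (c' + (L - c') / 2) * real n" using L[of n] by linarith
      then have "L \<le> c' + (L - c') / 2" using elim by simp
      then show ?case using c' by (simp add: field_simps)
    qed
    then show False by simp
  qed
  ultimately have "AE x in M. x \<notin> G" by (intro prob_eq_0[THEN iffD1]) auto
  with AE_space show ?thesis
  proof eventually_elim
    case (elim x)
    then have "ereal c < liminf (\<lambda>n. ereal (f n x / real n))"
      using c' less_le_trans[of "ereal c" "ereal c'"] by (auto simp: G_def g_def not_less)
    then have "\<forall>\<^sub>F n in sequentially. ereal c < ereal (f n x / real n)"
      by (rule less_LiminfD)
    then show ?case using eventually_ge_at_top[of 1]
      by eventually_elim (auto simp: field_simps)
  qed
qed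

end

section \<open>The Bernoulli shift\<close>

text \<open>One-sided, since the iterates of the cocycle read only the coordinates from 0 on; shift
  invariant events then are tail events, which gives the zero-one law directly.\<close>

definition bernoulli_nat :: "'s pmf \<Rightarrow> (nat \<Rightarrow> 's) measure" where
  "bernoulli_nat q = (\<Pi>\<^sub>M n\<in>(UNIV :: nat set). measure_pmf q)"

lemma space_bernoulli_nat [simp]: "space (bernoulli_nat q) = UNIV"
  by (simp add: bernoulli_nat_def space_PiM)

lemma prob_space_bernoulli_nat: "prob_space (bernoulli_nat q)"
  unfolding bernoulli_nat_def by (rule prob_space_PiM) (rule measure_pmf.prob_space_axioms)

lemma measurable_bernoulli_nat_component [measurable]:
  "(\<lambda>x. x n) \<in> measurable (bernoulli_nat q) (count_space UNIV)"
proof -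
  have "(\<lambda>x. x n) \<in> measurable (bernoulli_nat q) (measure_pmf q)"
    unfolding bernoulli_nat_def by measurable
  then show ?thesis by simp
qed

lemma bernoulli_nat_reindex:
  assumes "inj t"
  shows "distr (PiM UNIV (\<lambda>_. measure_pmf q)) (bernoulli_nat q) (\<lambda>x n. x (t n)) = bernoulli_nat q"
  using distr_PiM_reindex[of UNIV "\<lambda>_. measure_pmf q" t UNIV] assms
  by (simp add: bernoulli_nat_def measure_pmf.prob_space_axioms restrict_UNIV)

text \<open>Steps \<open>d\<close> other than 1 occur because the upper bound for the exponent uses
  blocks of \<open>m\<close> letters, hence ergodicity of the \<open>m\<close>-th power of the
  shift.\<close>

abbreviation (input) shift_by :: "nat \<Rightarrow> (nat \<Rightarrow> 's) \<Rightarrow> nat \<Rightarrow> 's" where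
  "shift_by d \<equiv> \<lambda>x k. x (k + d)"

lemma funpow_shift_by: "(shift_by d ^^ n) x = (\<lambda>k. x (k + d * n))"
  by (induction n) (auto simp: algebra_simps)

lemma measure_preserving_shift_by: "measure_preserving (bernoulli_nat q) (shift_by d)"
proof -
  have "shift_by d \<in> measurable (bernoulli_nat q) (bernoulli_nat q)"
    unfolding bernoulli_nat_def
    by (rule measurable_PiM_single') (auto simp flip: bernoulli_nat_def)
  moreover have "distr (bernoulli_nat q) (bernoulli_nat q) (shift_by d) = bernoulli_nat q"
    using bernoulli_nat_reindex[of "\<lambda>n::nat. n + d" q] by (simp add: bernoulli_nat_def inj_def)
  ultimately show ?thesis
    using prob_space_bernoulli_nat by (intro measure_preserving.intro measure_preserving_axioms.intro)
qed

text \<open>The preimage of \<open>G\<close> under the \<open>n\<close>-th iterate depends only on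
  the coordinates \<open>k + d * n\<close>, all at least \<open>n\<close> because
  \<open>d \<ge> 1\<close>. As it equals \<open>G\<close>, the event \<open>G\<close> is a tail
  event and Kolmogorov's law applies.\<close>

lemma bernoulli_nat_zero_one:
  assumes G: "G \<in> sets (bernoulli_nat q)" and inv: "\<And>x. shift_by d x \<in> G \<longleftrightarrow> x \<in> G" and "d \<ge> 1"
  shows "measure (bernoulli_nat q) G = 0 \<or> measure (bernoulli_nat q) G = 1"
proof -
  interpret prob_space "bernoulli_nat q" by (rule prob_space_bernoulli_nat)
  define F :: "nat \<Rightarrow> (nat \<Rightarrow> 'a) set set" where "F i = {(\<lambda>x. x i) -` B | B. True}" for i
  have vimage: "F i = sets (vimage_algebra UNIV (\<lambda>x. x i) (measure_pmf q))" for i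
    by (subst sets_vimage_algebra2) (auto simp: F_def)
  have sigma: "sigma_algebra (space (bernoulli_nat q)) (F i)" for i
    using sets.sigma_algebra_axioms[of "vimage_algebra UNIV (\<lambda>x. x i) (measure_pmf q)"]
    by (simp add: vimage)
  have "indep_vars (\<lambda>_. measure_pmf q) (\<lambda>i x. x i) (UNIV :: nat set)"
  proof (subst indep_vars_iff_distr_eq_PiM')
    show "distr (bernoulli_nat q) (\<Pi>\<^sub>M i\<in>UNIV. measure_pmf q) (\<lambda>x. \<lambda>i\<in>UNIV. x i) =
        (\<Pi>\<^sub>M i\<in>UNIV. distr (bernoulli_nat q) (measure_pmf q) (\<lambda>x. x i))"
    proof -
      have "distr (bernoulli_nat q) (measure_pmf q) (\<lambda>x. x i) = measure_pmf q" for i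
        unfolding bernoulli_nat_def
        by (rule distr_PiM_component) (auto intro: measure_pmf.prob_space_axioms)
      then show ?thesis by (simp add: bernoulli_nat_def distr_id restrict_UNIV)
    qed
  qed auto
  then have indep: "indep_sets F UNIV"
    by (simp add: indep_vars_def2 F_def[abs_def])
  have "G \<in> tail_events F"
    unfolding tail_events_def
  proof
    fix n :: nat
    define N where "N = sigma UNIV (\<Union>i\<in>{n..}. F i)"
    have "(shift_by d ^^ n) \<in> measurable N (bernoulli_nat q)"
      unfolding bernoulli_nat_def
    proof (rule measurable_PiM_single')
      fix k :: nat
      show "(\<lambda>x. (shift_by d ^^ n) x k) \<in> measurable N (measure_pmf q)"
      proof (rule measurableI)
        fix B :: "'a set"
        have "n \<le> k + d * n" using \<open>d \<ge> 1\<close> by (cases d) auto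
        then have "(\<lambda>x. x (k + d * n)) -` B \<in> (\<Union>i\<in>{n..}. F i)" by (auto simp: F_def)
        then show "(\<lambda>x. (shift_by d ^^ n) x k) -` B \<inter> space N \<in> sets N"
          by (simp add: N_def funpow_shift_by)
      qed simp
    qed auto
    from measurable_sets[OF this G] have "(shift_by d ^^ n) -` G \<in> sets N"
      by (simp add: N_def)
    moreover have "(shift_by d ^^ n) x \<in> G \<longleftrightarrow> x \<in> G" for x
      by (induction n) (auto simp: inv)
    then have "(shift_by d ^^ n) -` G = G" by auto
    ultimately show "G \<in> sigma_sets (space (bernoulli_nat q)) (\<Union>i\<in>{n..}. F i)"
      by (simp add: N_def)
  qed
  from kolmogorov_0_1_law[OF sigma indep this] show ?thesis .
qed

section \<open>Existence of the Lyapunov exponent\<close>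

text \<open>The first letter acts first, so the prefix of length \<open>n\<close> of a sequence
  yields the \<open>n\<close>-th iterate of the cocycle, and appending a letter multiplies on the
  left.\<close>

primrec wprod :: "('s \<Rightarrow> real^2^2) \<Rightarrow> 's list \<Rightarrow> real^2^2" where
  "wprod A [] = mat 1"
| "wprod A (i # w) = wprod A w ** A i"

lemma wprod_append: "wprod A (u @ w) = wprod A w ** wprod A u"
  by (induction u) (auto simp: matrix_mul_assoc)

lemma det_wprod: "(\<And>i. i \<in> set w \<Longrightarrow> A i \<in> SL2) \<Longrightarrow> det (wprod A w) = 1"
  by (induction w) (auto simp: det_mul SL2_def)

section \<open>Operator norm and determinant in dimension two\<close>

lemma norm_mult_op_norm: "norm (M *v v) \<le> op_norm M * norm v"
  unfolding op_norm_def by (rule onorm) (rule matrix_vector_mul_bounded_linear)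

lemma op_norm_nonneg [simp]: "0 \<le> op_norm M"
  unfolding op_norm_def by (rule onorm_pos_le) (rule matrix_vector_mul_bounded_linear)

lemma op_norm_leI: "0 \<le> b \<Longrightarrow> (\<And>v. norm (M *v v) \<le> b * norm v) \<Longrightarrow> op_norm M \<le> b"
  unfolding op_norm_def by (rule onorm_bound)

lemma op_norm_mult: "op_norm (M ** N) \<le> op_norm M * op_norm N"
proof (rule op_norm_leI)
  fix v
  have "norm ((M ** N) *v v) \<le> op_norm M * norm (N *v v)"
    by (simp add: norm_mult_op_norm flip: matrix_vector_mul_assoc)
  also have "\<dots> \<le> op_norm M * (op_norm N * norm v)"
    by (intro mult_left_mono norm_mult_op_norm) auto
  finally show "norm ((M ** N) *v v) \<le> op_norm M * op_norm N * norm v" by simp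
qed simp

text \<open>The determinant with columns \<open>u\<close> and \<open>v\<close>. It stands in for the
  angle between two lines: it vanishes for parallel vectors and is preserved by matrices of
  determinant one.\<close>

definition cross2 :: "real^2 \<Rightarrow> real^2 \<Rightarrow> real" where
  "cross2 u v = u$1 * v$2 - u$2 * v$1"

lemma abs_cross2_le: "\<bar>cross2 u v\<bar> \<le> norm u * norm v"
proof -
  have "norm x ^ 2 = (x$1)\<^sup>2 + (x$2)\<^sup>2" for x :: "real^2"
    by (simp add: norm_vec_def L2_set_def UNIV_2)
  then have "(norm u * norm v)\<^sup>2 = (cross2 u v)\<^sup>2 + (u$1 * v$1 + u$2 * v$2)\<^sup>2"
    unfolding cross2_def power_mult_distrib by (simp add: power2_eq_square algebra_simps)
  then have "(cross2 u v)\<^sup>2 \<le> (norm u * norm v)\<^sup>2" by simp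
  from power2_le_imp_le[of "\<bar>cross2 u v\<bar>"] this show ?thesis by simp
qed

lemma cross2_mult: "cross2 (M *v u) (M *v v) = det M * cross2 u v"
  by (simp add: cross2_def det_2 matrix_vector_mult_def UNIV_2 algebra_simps)

text \<open>The images of the two basis vectors still span a parallelogram of area one, so they
  cannot both be shorter than one.\<close>

lemma op_norm_ge_1:
  assumes "det M = 1"
  shows "1 \<le> op_norm M"
proof -
  let ?e1 = "axis 1 1 :: real^2" and ?e2 = "axis 2 1 :: real^2"
  have "1 = \<bar>cross2 (M *v ?e1) (M *v ?e2)\<bar>" using assms by (simp add: cross2_mult) (simp add: cross2_def axis_def)
  also have "\<dots> \<le> norm (M *v ?e1) * norm (M *v ?e2)" by (rule abs_cross2_le)
  also have "\<dots> \<le> (op_norm M * norm ?e1) * (op_norm M * norm ?e2)"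
    by (intro mult_mono norm_mult_op_norm) auto
  finally have "1 \<le> (op_norm M)\<^sup>2" by (simp add: power2_eq_square)
  then show ?thesis using power2_le_imp_le[of 1 "op_norm M"] by simp
qed

lemma matrix_inv_SL2:
  fixes M :: "real^2^2"
  assumes "det M = 1"
  shows "M ** matrix_inv M = mat 1" "matrix_inv M ** M = mat 1" "det (matrix_inv M) = 1"
proof -
  have "invertible M" using assms invertible_det_nz[of M] by simp
  then have "M ** matrix_inv M = mat 1 \<and> matrix_inv M ** M = mat 1"
    unfolding invertible_def matrix_inv_def by (rule someI_ex)
  then show inv: "M ** matrix_inv M = mat 1" "matrix_inv M ** M = mat 1" by auto
  show "det (matrix_inv M) = 1" using arg_cong[OF inv(1), of det] assms by (simp add: det_mul)
qed

text \<open>Over a finite alphabet the words form a countable set; with \<open>count_space\<close>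
  as target, every function of the prefix, such as the norm of its product, is measurable.\<close>

lemma measurable_prefix [measurable]:
  "(\<lambda>x. map x [0..<n]) \<in> measurable (bernoulli_nat (q :: 's::finite pmf)) (count_space UNIV)"
proof -
  have "(\<lambda>x. map x [0..<n]) -` {w} \<inter> space (bernoulli_nat q) \<in> sets (bernoulli_nat q)" for w :: "'s list"
  proof (cases "length w = n")
    case True
    then have "map x [0..<n] = w \<longleftrightarrow> (\<forall>i<n. x i = w ! i)" for x
      using list_eq_iff_nth_eq[of "map x [0..<n]" w] by simp
    then have "(\<lambda>x. map x [0..<n]) -` {w} = {x \<in> space (bernoulli_nat q). \<forall>i\<in>{..<n}. x i = w ! i}"
      by (simp add: vimage_def Ball_def)
    moreover have "{x \<in> space (bernoulli_nat q). x i = w ! i} \<in> sets (bernoulli_nat q)" for i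
      using measurable_sets[OF measurable_bernoulli_nat_component[of i q], of "{w ! i}"] by (simp add: vimage_def)
    then have "{x \<in> space (bernoulli_nat q). \<forall>i\<in>{..<n}. x i = w ! i} \<in> sets (bernoulli_nat q)"
      by (intro sets.sets_Collect_finite_All) auto
    ultimately show ?thesis by simp
  next
    case False
    then have "(\<lambda>x. map x [0..<n]) -` {w} = {}" by auto
    then show ?thesis by simp
  qed
  then show ?thesis by (subst measurable_count_space_eq2_countable) auto
qed

text \<open>The limit is \<open>L\<close>, the infimum of the normalised expectations. The lower
  bound is \<open>subadditive_liminf_ge\<close> for \<open>f\<close>. For \<open>L < c\<close>, some
  block length \<open>m\<close> has normalised expectation below \<open>c\<close>; cutting words
  into blocks of \<open>m\<close> letters bounds \<open>f\<close> by an ergodic sum of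
  \<open>f m\<close>, and the same lemma for the negated sum supplies the law of large
  numbers.\<close>

lemma furstenberg_kesten:
  fixes q :: "'s::finite pmf" and B :: "'s \<Rightarrow> real^2^2"
  assumes SL2: "\<And>i. B i \<in> SL2"
  shows "\<exists>c. AE x in bernoulli_nat q.
    (\<lambda>n. ln (op_norm (wprod B (map x [0..<n]))) / real n) \<longlonglongrightarrow> c"
proof -
  define f where "f n x = ln (op_norm (wprod B (map x [0..<n])))" for n and x :: "nat \<Rightarrow> 's"
  \<comment> \<open>Inverses enter because dropping a letter at either end of a word multiplies its
    product by the inverse of that letter; this makes \<open>f n\<close> almost invariant under the
    shift (\<open>f_diff\<close>).\<close>
  define K where "K = (\<Sum>i\<in>UNIV. ln (op_norm (B i)) + ln (op_norm (matrix_inv (B i))))"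
  have det_B: "det (B i) = 1" for i using SL2[of i] by (simp add: SL2_def)
  note inv = matrix_inv_SL2(1,2)[OF det_B] and det_inv = matrix_inv_SL2(3)[OF det_B]
  have ln_B: "0 \<le> ln (op_norm (B i))" "0 \<le> ln (op_norm (matrix_inv (B i)))" for i
    using op_norm_ge_1[OF det_B[of i]] op_norm_ge_1[OF det_inv[of i]] by auto
  have K_le: "ln (op_norm (B i)) \<le> K" "ln (op_norm (matrix_inv (B i))) \<le> K" for i
  proof -
    have "ln (op_norm (B i)) + ln (op_norm (matrix_inv (B i))) \<le> K"
      unfolding K_def
      by (rule member_le_sum[of i UNIV "\<lambda>i. ln (op_norm (B i)) + ln (op_norm (matrix_inv (B i)))"])
        (auto intro: add_nonneg_nonneg ln_B)
    then show "ln (op_norm (B i)) \<le> K" "ln (op_norm (matrix_inv (B i))) \<le> K"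
      using ln_B[of i] by linarith+
  qed
  have K0: "0 \<le> K" using ln_B(1) K_le(1) order_trans by blast
  have ln_mult_le: "ln (op_norm (M ** N)) \<le> ln (op_norm M) + ln (op_norm N)" if "det M = 1" "det N = 1" for M N :: "real^2^2"
  proof -
    have "1 \<le> op_norm (M ** N)" "1 \<le> op_norm M" "1 \<le> op_norm N"
      using that by (auto intro!: op_norm_ge_1 simp: det_mul)
    then show ?thesis using op_norm_mult[of M N] by (simp flip: ln_mult_pos)
  qed
  have det_w: "det (wprod B w) = 1" for w using SL2 by (intro det_wprod) auto
  have split: "map x [0..<n + k] = map x [0..<n] @ map (shift_by n x) [0..<k]" for n k and x :: "nat \<Rightarrow> 's"
    by (rule nth_equalityI) (auto simp: nth_append)
  have f_sub: "f (n + k) x \<le> f n x + f k (shift_by n x)" for n k x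
    using ln_mult_le[OF det_w det_w, of "map (shift_by n x) [0..<k]" "map x [0..<n]"]
    unfolding f_def split wprod_append by (simp add: add.commute)
  have f_nonneg: "0 \<le> f n x" for n x
    unfolding f_def using op_norm_ge_1[OF det_w] by simp
  have f_1: "f 1 x \<le> K" for x using K_le by (simp add: f_def)
  have f_0: "f 0 x = 0" for x
    using f_sub[of 0 0 x] f_nonneg[of 0 x] op_norm_leI[of 1 "mat 1"] op_norm_ge_1[of "mat 1"]
    by (auto simp: f_def)
  have f_le: "f n x \<le> K * real n" for n x
  proof (induction n)
    case (Suc n)
    then show ?case using f_sub[of n 1 x] f_1[of "shift_by n x"] by (simp add: algebra_simps)
  qed (simp add: f_0)
  have f_Suc: "f n x \<le> f (Suc n) x + K" for n x
  proof -
    have "ln (op_norm (wprod B (map x [0..<n]))) = ln (op_norm (matrix_inv (B (x n)) ** wprod B (map x [0..<Suc n])))"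
      by (simp add: wprod_append matrix_mul_assoc inv)
    also have "\<dots> \<le> ln (op_norm (matrix_inv (B (x n)))) + ln (op_norm (wprod B (map x [0..<Suc n])))"
      by (intro ln_mult_le det_inv det_w)
    finally show ?thesis using K_le(2)[of "x n"] unfolding f_def by linarith
  qed
  have f_shift: "f n (shift_by 1 x) \<le> f (Suc n) x + K" for n x
  proof -
    have eq: "map x [0..<Suc n] = x 0 # map (shift_by 1 x) [0..<n]"
      using split[of x 1 n] by simp
    have "ln (op_norm (wprod B (map (shift_by 1 x) [0..<n])))
        = ln (op_norm (wprod B (map x [0..<Suc n]) ** matrix_inv (B (x 0))))"
      unfolding eq by (simp add: inv flip: matrix_mul_assoc)
    also have "\<dots> \<le> ln (op_norm (wprod B (map x [0..<Suc n]))) + ln (op_norm (matrix_inv (B (x 0))))"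
      by (intro ln_mult_le det_inv det_w)
    finally show ?thesis using K_le(2)[of "x 0"] unfolding f_def by linarith
  qed
  have f_diff: "\<bar>f n (shift_by 1 x) - f n x\<bar> \<le> 2 * K" for n x
    using f_shift[of n x] f_Suc[of n x] f_sub[of n 1 x] f_sub[of 1 n x] f_1[of x] f_1[of "shift_by n x"]
    by simp
  have f_growth: "f (n + j) x \<le> f n x + K * real j" for n j x
  proof (induction j)
    case (Suc j)
    then show ?case using f_sub[of "n + j" 1 x] f_1[of "shift_by (n + j) x"]
      by (simp add: algebra_simps)
  qed simp
  have [measurable]: "f n \<in> borel_measurable (bernoulli_nat q)" for n
  proof -
    have "(\<lambda>x. (\<lambda>w. ln (op_norm (wprod B w))) (map x [0..<n])) \<in> borel_measurable (bernoulli_nat q)"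
      by (rule measurable_compose[OF measurable_prefix]) simp
    then show ?thesis by (simp add: f_def[abs_def])
  qed
  interpret prob_space "bernoulli_nat q" by (rule prob_space_bernoulli_nat)
  define a where "a n = expectation (f n) / real n" for n
  define L where "L = (INF n\<in>{1..}. a n)"
  have a_nonneg: "0 \<le> a n" for n
    unfolding a_def using f_nonneg by (intro divide_nonneg_nonneg integral_nonneg) auto
  have bdd: "bdd_below (a ` {1..})" using a_nonneg by (intro bdd_belowI[of _ 0]) auto
  have lower: "AE x in bernoulli_nat q. \<forall>\<^sub>F n in sequentially. c * real n \<le> f n x" if "c < L" for c
  proof -
    interpret T: measure_preserving "bernoulli_nat q" "shift_by 1" by (rule measure_preserving_shift_by)
    show ?thesis
    proof (rule T.subadditive_liminf_ge[where L = L and K = K and C = "2 * K"])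
      show "L * real n \<le> expectation (f n)" if "n \<ge> 1" for n
      proof -
        have "L \<le> a n" unfolding L_def using bdd that by (intro cINF_lower) auto
        then show ?thesis using that by (simp add: a_def field_simps)
      qed
      show "prob G = 0 \<or> prob G = 1"
        if "G \<in> events" "\<And>x. x \<in> space (bernoulli_nat q) \<Longrightarrow> shift_by 1 x \<in> G \<longleftrightarrow> x \<in> G" for G
        by (rule bernoulli_nat_zero_one[where d = 1]) (use that in auto)
      show "f (n + k) x \<le> f n x + f k ((shift_by 1 ^^ n) x)" for n k x
        using f_sub[of n k x] by (simp only: funpow_shift_by mult_1)
      show "\<bar>f n (shift_by 1 x) - f n x\<bar> \<le> 2 * K" for n x by (rule f_diff)
    qed (use f_nonneg f_le that in auto)
  qed
  have upper: "AE x in bernoulli_nat q. \<forall>\<^sub>F n in sequentially. f n x \<le> c * real n" if L_c: "L < c" for c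
  proof -
    obtain m where m: "m \<ge> 1" "a m < c"
      using L_c bdd cINF_less_iff[of "{1..}" a c] by (auto simp: L_def)
    obtain c' where c': "a m < c'" "c' < c" using dense m by blast
    have c'_pos: "c' > 0" using a_nonneg[of m] c' by linarith
    interpret T: measure_preserving "bernoulli_nat q" "shift_by m" by (rule measure_preserving_shift_by)
    define S where "S k x = - (\<Sum>i<k. f m (shift_by (m * i) x))" for k x
    have S_eq: "S k x = - (\<Sum>i<k. f m ((shift_by m ^^ i) x))" for k x
      by (simp add: S_def funpow_shift_by)
    have int: "integrable (bernoulli_nat q) (\<lambda>x. f m ((shift_by m ^^ i) x))" for i
      using f_nonneg f_le by (intro integrable_const_bound[where B = "K * real m"]) auto
    have "AE x in bernoulli_nat q. \<forall>\<^sub>F k in sequentially. (- (c' * real m)) * real k \<le> S k x"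
    proof (rule T.subadditive_liminf_ge[where L = "- expectation (f m)" and K = "K * real m" and C = "2 * K * real m"])
      show "S n \<in> borel_measurable (bernoulli_nat q)" for n
        unfolding S_eq[abs_def] by measurable
      show "\<bar>S n x\<bar> \<le> K * real m * real n" for n x
      proof -
        have "\<bar>S n x\<bar> \<le> (\<Sum>i<n. K * real m)"
          unfolding S_def abs_minus_cancel using f_nonneg f_le
          by (intro order_trans[OF sum_abs] sum_mono) auto
        then show ?thesis by (simp add: mult.commute)
      qed
      show "S (n + k) x \<le> S n x + S k ((shift_by m ^^ n) x)" for n k x
      proof -
        have "(\<Sum>i<n + k. f m (shift_by (m * i) x)) = (\<Sum>i<n. f m (shift_by (m * i) x))
            + (\<Sum>i<k. f m (shift_by (m * (n + i)) x))"
          by (induction k) auto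
        then show ?thesis by (simp add: S_def funpow_shift_by algebra_simps)
      qed
      show "\<bar>S n (shift_by m x) - S n x\<bar> \<le> 2 * K * real m" for n x
      proof -
        have "S n (shift_by m x) - S n x = f m x - f m (shift_by (m * n) x)"
          by (induction n) (auto simp: S_def algebra_simps)
        then show ?thesis
          using f_nonneg[of m x] f_nonneg[of m "shift_by (m * n) x"] f_le[of m x] f_le[of m "shift_by (m * n) x"]
          by simp
      qed
      show "- expectation (f m) * real n \<le> expectation (S n)" for n
      proof -
        have "expectation (S n) = - (\<Sum>i<n. expectation (\<lambda>x. f m ((shift_by m ^^ i) x)))"
          unfolding S_eq[abs_def] using int by (simp add: Bochner_Integration.integral_sum)
        also have "\<dots> = - expectation (f m) * real n"
          by (subst T.expectation_funpow) auto
        finally show ?thesis by simp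
      qed
      show "- (c' * real m) < - expectation (f m)"
        using c' m by (simp add: a_def field_simps)
      show "prob G = 0 \<or> prob G = 1"
        if "G \<in> events" "\<And>x. x \<in> space (bernoulli_nat q) \<Longrightarrow> shift_by m x \<in> G \<longleftrightarrow> x \<in> G" for G
        by (rule bernoulli_nat_zero_one[where d = m]) (use that m in auto)
    qed
    then show ?thesis
    proof eventually_elim
      case (elim x)
      have block: "f (m * k) x \<le> - S k x" for k
      proof (induction k)
        case (Suc k)
        then show ?case using f_sub[of "m * k" m x] by (simp add: S_def add.commute)
      qed (simp add: S_def f_0)
      have "filterlim (\<lambda>n. n div m) at_top sequentially"
        unfolding filterlim_at_top
      proof
        fix Z
        show "\<forall>\<^sub>F n in sequentially. Z \<le> n div m"
          using eventually_ge_at_top[of "Z * m"]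
        proof eventually_elim
          case (elim n)
          then show ?case using div_le_mono[OF elim, of m] m by simp
        qed
      qed
      from eventually_compose_filterlim[OF elim this]
      have "\<forall>\<^sub>F n in sequentially. - (c' * real m) * real (n div m) \<le> S (n div m) x" .
      moreover have "\<forall>\<^sub>F n in sequentially. K * real m / (c - c') \<le> real n"
        using filterlim_real_sequentially by (auto simp: filterlim_at_top)
      ultimately show ?case
      proof eventually_elim
        case (elim n)
        \<comment> \<open>The \<open>n mod m\<close> letters outside the complete blocks cost at
          most \<open>K * m\<close>, which the gap between \<open>c'\<close> and \<open>c\<close>
          absorbs for large \<open>n\<close>.\<close>
        have n: "n = m * (n div m) + n mod m" by simp
        have "f n x \<le> f (m * (n div m)) x + K * real (n mod m)"
          using f_growth[of "m * (n div m)" "n mod m" x] by simp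
        also have "\<dots> \<le> c' * real (m * (n div m)) + K * real m"
          using elim(1) block[of "n div m"] m K0
          by (intro add_mono mult_left_mono) (auto simp: algebra_simps intro: less_imp_le)
        also have "\<dots> \<le> c' * real n + K * real m"
          using c'_pos times_div_less_eq_dividend[of m n]
          by (intro add_right_mono mult_left_mono) (simp_all only: of_nat_le_iff less_imp_le)
        also have "\<dots> \<le> c' * real n + (c - c') * real n"
          using elim(2) c' by (simp add: field_simps)
        finally show ?case by (simp add: algebra_simps)
      qed
    qed
  qed
  have "AE x in bernoulli_nat q. \<forall>j. (\<forall>\<^sub>F n in sequentially. (L - 1 / Suc j) * real n \<le> f n x)
      \<and> (\<forall>\<^sub>F n in sequentially. f n x \<le> (L + 1 / Suc j) * real n)"
    unfolding AE_all_countable using lower upper by (auto intro!: AE_conjI)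
  then have "AE x in bernoulli_nat q. (\<lambda>n. f n x / real n) \<longlonglongrightarrow> L"
  proof eventually_elim
    case (elim x)
    show ?case
    proof (rule tendstoI)
      fix e :: real assume "e > 0"
      then obtain j where j: "1 / real (Suc j) < e"
        using nat_approx_posE by blast
      have "\<forall>\<^sub>F n in sequentially. (L - 1 / Suc j) * real n \<le> f n x"
        "\<forall>\<^sub>F n in sequentially. f n x \<le> (L + 1 / Suc j) * real n" using elim by auto
      then show "\<forall>\<^sub>F n in sequentially. dist (f n x / real n) L < e"
        using eventually_ge_at_top[of 1]
      proof eventually_elim
        case (elim n)
        then have "L - 1 / Suc j \<le> f n x / real n" "f n x / real n \<le> L + 1 / Suc j"
          by (auto simp: pos_le_divide_eq pos_divide_le_eq)
        then show ?case using j by (auto simp: dist_real_def abs_less_iff)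
      qed
    qed
  qed
  then show ?thesis unfolding f_def by blast
qed

lemma cocycle_iterate_eq_wprod:
  "cocycle_iterate A n x = wprod A (map (\<lambda>k. x (int k)) [0..<n])"
proof -
  have "(shift ^^ n) x k = x (k + int n)" for n k
    by (induction n arbitrary: k) (auto simp: shift_def algebra_simps)
  then show ?thesis by (induction n) (auto simp: wprod_append)
qed

text \<open>Reading the coordinates from 0 on maps the two-sided measure to the one-sided one, so
  the convergence carries over; the almost sure limit is unique because the total mass is one, so
  the definite description picks it.\<close>

lemma lyapunov_exponent_AE:
  fixes q :: "'s::finite pmf" and B :: "'s \<Rightarrow> real^2^2"
  assumes SL2: "\<And>i. B i \<in> SL2"
  shows "AE x in bernoulli_nat q.
    (\<lambda>n. ln (op_norm (wprod B (map x [0..<n]))) / real n) \<longlonglongrightarrow> lyapunov_exponent q B"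
proof -
  have distr: "distr (bernoulli q) (bernoulli_nat q) (\<lambda>x n. x (int n)) = bernoulli_nat q"
    unfolding bernoulli_def by (rule bernoulli_nat_reindex) simp
  have meas: "(\<lambda>x n. x (int n)) \<in> measurable (bernoulli q) (bernoulli_nat q)"
    unfolding bernoulli_nat_def bernoulli_def
    by (rule measurable_PiM_single') (auto intro: measurable_component_singleton simp del: measurable_pmf_measure2)
  interpret prob_space "bernoulli q"
    unfolding bernoulli_def by (rule prob_space_PiM) (rule measure_pmf.prob_space_axioms)
  obtain c where c: "AE x in bernoulli_nat q.
      (\<lambda>n. ln (op_norm (wprod B (map x [0..<n]))) / real n) \<longlonglongrightarrow> c"
    using furstenberg_kesten[of B q] SL2 by blast
  have "AE x in distr (bernoulli q) (bernoulli_nat q) (\<lambda>x n. x (int n)).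
      (\<lambda>n. ln (op_norm (wprod B (map x [0..<n]))) / real n) \<longlonglongrightarrow> c"
    using c by (subst distr)
  from AE_distrD[OF meas this]
  have ae: "AE x in bernoulli q. (\<lambda>n. ln (op_norm (cocycle_iterate B n x)) / real n) \<longlonglongrightarrow> c"
    by (simp add: cocycle_iterate_eq_wprod)
  have "lyapunov_exponent q B = c"
    unfolding lyapunov_exponent_def
  proof (rule the_equality)
    show "AE x in bernoulli q. (\<lambda>n. ln (op_norm (cocycle_iterate B n x)) / real n) \<longlonglongrightarrow> c" by (rule ae)
  next
    fix c' assume "AE x in bernoulli q. (\<lambda>n. ln (op_norm (cocycle_iterate B n x)) / real n) \<longlonglongrightarrow> c'"
    with ae have "AE x in bernoulli q. c' = c"
      by eventually_elim (rule LIMSEQ_unique)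
    then show "c' = c" by simp
  qed
  then show ?thesis using c by simp
qed

section \<open>Contraction on square integrable functions\<close>

lemma distr_lborel_SL2:
  fixes M :: "real^2^2"
  assumes "det M = 1"
  shows "distr lborel borel (\<lambda>v. M *v v) = lborel"
proof (rule lborel_eqI[symmetric])
  fix l u :: "real^2"
  assume le: "\<And>b. b \<in> Basis \<Longrightarrow> l \<bullet> b \<le> u \<bullet> b"
  let ?N = "matrix_inv M"
  note inv = matrix_inv_SL2[OF assms]
  have pre: "(\<lambda>v. M *v v) -` box l u = (\<lambda>v. ?N *v v) ` box l u"
  proof (intro set_eqI iffI)
    fix v assume "v \<in> (\<lambda>v. M *v v) -` box l u"
    moreover have "v = ?N *v (M *v v)" by (simp add: matrix_vector_mul_assoc inv)
    ultimately show "v \<in> (\<lambda>v. ?N *v v) ` box l u" by blast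
  qed (auto simp: matrix_vector_mul_assoc inv)
  have meas: "(\<lambda>v. M *v v) \<in> borel_measurable borel"
    by (intro borel_measurable_continuous_onI continuous_intros)
  have borel: "(\<lambda>v. ?N *v v) ` box l u \<in> sets borel"
    using measurable_sets[OF meas, of "box l u"] by (simp add: pre)
  have lm: "(\<lambda>v. ?N *v v) ` box l u \<in> lmeasurable"
    by (rule measurable_linear_image) (auto intro: matrix_vector_mul_linear)
  have "emeasure (distr lborel borel (\<lambda>v. M *v v)) (box l u) = emeasure lborel ((\<lambda>v. ?N *v v) ` box l u)"
    using meas by (subst emeasure_distr) (auto simp: pre)
  also have "\<dots> = emeasure lebesgue ((\<lambda>v. ?N *v v) ` box l u)"
    using borel by simp
  also have "\<dots> = ennreal (measure lebesgue ((\<lambda>v. ?N *v v) ` box l u))"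
    using lm by (simp add: emeasure_eq_measure2)
  also have "\<dots> = ennreal (measure lebesgue (box l u))"
    by (subst measure_linear_image) (auto intro: matrix_vector_mul_linear simp: matrix_of_matrix_vector_mul inv)
  also have "measure lebesgue (box l u) = (\<Prod>b\<in>Basis. (u - l) \<bullet> b)"
    using le by (simp add: measure_lborel_box_eq)
  finally show "emeasure (distr lborel borel (\<lambda>v. M *v v)) (box l u) = (\<Prod>b\<in>Basis. (u - l) \<bullet> b)" .
qed simp

lemma nn_integral_SL2:
  fixes M :: "real^2^2"
  assumes "det M = 1" and [measurable]: "h \<in> borel_measurable borel"
  shows "(\<integral>\<^sup>+v. h (M *v v) \<partial>lborel) = (\<integral>\<^sup>+v. h v \<partial>lborel)"
proof -
  have meas [measurable]: "(\<lambda>v. M *v v) \<in> borel_measurable borel"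
    by (intro borel_measurable_continuous_onI continuous_intros)
  have "(\<integral>\<^sup>+v. h v \<partial>lborel) = (\<integral>\<^sup>+v. h v \<partial>distr lborel borel (\<lambda>v. M *v v))"
    by (simp add: distr_lborel_SL2 assms)
  also have "\<dots> = (\<integral>\<^sup>+v. h (M *v v) \<partial>lborel)" by (rule nn_integral_distr) auto
  finally show ?thesis by simp
qed

text \<open>The proof bounds the square of the average over \<open>S\<close> by splitting each \<open>f (g i *v v)\<close>
  according to whether \<open>v \<in> V i\<close> or \<open>g i *v v \<in> U i\<close>: the terms of the first kind have disjoint
  supports, the squares of those of the second kind integrate to at most the integral of \<open>f\<^sup>2\<close>
  altogether.\<close>

lemma ping_pong_contraction:
  fixes g :: "'i \<Rightarrow> real^2^2" and f :: "real^2 \<Rightarrow> real"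
  assumes W: "finite W" "S \<subseteq> W" "card S = 5"
    and det: "\<And>i. i \<in> W \<Longrightarrow> det (g i) = 1"
    and p: "\<And>i. i \<in> W \<Longrightarrow> 0 \<le> p i" "sum p W = 1"
    and p0: "0 \<le> p0" "\<And>i. i \<in> S \<Longrightarrow> p0 \<le> p i"
    and U [measurable]: "\<And>i. U i \<in> sets borel" and U_disj: "disjoint_family_on U S"
    and V [measurable]: "\<And>i. V i \<in> sets borel" and V_disj: "disjoint_family_on V S"
    and ping_pong: "\<And>i v. i \<in> S \<Longrightarrow> v \<noteq> 0 \<Longrightarrow> v \<in> V i \<or> g i *v v \<in> U i"
    and f [measurable]: "f \<in> borel_measurable borel"
  shows "(\<integral>\<^sup>+v. ennreal ((\<Sum>i\<in>W. p i * f (g i *v v))\<^sup>2) \<partial>lborel)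
      \<le> ennreal (1 - p0) * (\<integral>\<^sup>+v. ennreal ((f v)\<^sup>2) \<partial>lborel)"
proof -
  have S: "finite S" using W finite_subset by blast
  \<comment> \<open>The weight left once \<open>p0\<close> has been taken from each of the five
    members of \<open>S\<close>; what was taken is treated jointly, as mass \<open>5 * p0\<close> at
    the average \<open>a\<close>.\<close>
  define w where "w i = p i - (if i \<in> S then p0 else 0)" for i
  have w: "0 \<le> w i" if "i \<in> W" for i using p p0 that by (auto simp: w_def)
  have sum_S: "(\<Sum>i\<in>W. if i \<in> S then h i else 0) = sum h S" for h :: "'i \<Rightarrow> real"
    using W by (simp add: sum.If_cases Int_absorb1)
  have sum_w: "sum w W = 1 - 5 * p0"
    using p(2) W(3) by (simp add: w_def sum_subtractf sum_S)
  have [measurable]: "(\<lambda>v. M *v v) \<in> borel_measurable borel" for M :: "real^2^2"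
    by (intro borel_measurable_continuous_onI continuous_intros)
  define I where "I = (\<integral>\<^sup>+v. ennreal ((f v)\<^sup>2) \<partial>lborel)"
  define Y where "Y v = (\<Sum>i\<in>S. indicator (V i) v * (f (g i *v v))\<^sup>2)" for v
  define Z where "Z v = (\<Sum>i\<in>S. indicator (U i) (g i *v v) * (f (g i *v v))\<^sup>2)" for v
  define X where "X v = (\<Sum>i\<in>W. w i * (f (g i *v v))\<^sup>2)" for v
  have pointwise: "(\<Sum>i\<in>W. p i * f (g i *v v))\<^sup>2 \<le> X v + (2 * p0 / 5) * Y v + 2 * p0 * Z v" if "v \<noteq> 0" for v
  proof -
    define x where "x i = f (g i *v v)" for i
    define m where "m = (\<Sum>i\<in>W. p i * x i)"
    define a where "a = sum x S / 5"
    have m: "m = (\<Sum>i\<in>W. w i * x i) + 5 * p0 * a"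
    proof -
      have "(\<Sum>i\<in>W. p i * x i) = (\<Sum>i\<in>W. w i * x i + (if i \<in> S then p0 * x i else 0))"
        by (intro sum.cong) (auto simp: w_def algebra_simps)
      then show ?thesis
        by (simp add: m_def sum.distrib sum_S[of "\<lambda>i. p0 * x i"] a_def flip: sum_distrib_left)
    qed
    \<comment> \<open>Jensen's inequality as a nonnegative variance about the mean \<open>m\<close>,
      for masses \<open>w i\<close> at \<open>x i\<close> and \<open>5 * p0\<close> at
      \<open>a\<close>.\<close>
    have "0 \<le> (\<Sum>i\<in>W. w i * (x i - m)\<^sup>2) + 5 * p0 * (a - m)\<^sup>2"
      using w p0 by (intro add_nonneg_nonneg sum_nonneg mult_nonneg_nonneg) auto
    also have "(\<Sum>i\<in>W. w i * (x i - m)\<^sup>2) = (\<Sum>i\<in>W. w i * (x i)\<^sup>2) - 2 * m * (\<Sum>i\<in>W. w i * x i) + m\<^sup>2 * sum w W"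
      by (simp add: power2_diff algebra_simps sum.distrib sum_subtractf sum_distrib_left sum_distrib_right)
    also have "\<dots> + 5 * p0 * (a - m)\<^sup>2 = (\<Sum>i\<in>W. w i * (x i)\<^sup>2) + 5 * p0 * a\<^sup>2 - 2 * m * ((\<Sum>i\<in>W. w i * x i) + 5 * p0 * a) + m\<^sup>2"
      unfolding sum_w by (simp add: power2_diff algebra_simps)
    also have "\<dots> = (\<Sum>i\<in>W. w i * (x i)\<^sup>2) + 5 * p0 * a\<^sup>2 - m\<^sup>2"
      by (simp add: power2_eq_square flip: m)
    finally have jensen: "m\<^sup>2 \<le> (\<Sum>i\<in>W. w i * (x i)\<^sup>2) + 5 * p0 * a\<^sup>2" by simp
    \<comment> \<open>At most one \<open>y i\<close> is nonzero, so their sum squares without cross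
      terms. A nonzero \<open>z i\<close> forces \<open>g i *v v \<in> U i\<close>; for these the
      Cauchy-Schwarz factor 5 is affordable, because \<open>Z\<close> integrates to at most one
      \<open>I\<close>.\<close>
    define y where "y i = (if v \<in> V i then x i else 0)" for i
    define z where "z i = x i - y i" for i
    have "sum x S = sum y S + sum z S" by (simp add: z_def sum_subtractf)
    then have "(sum x S)\<^sup>2 \<le> 2 * (sum y S)\<^sup>2 + 2 * (sum z S)\<^sup>2"
      using sum_squares_bound[of "sum y S" "sum z S"] by (simp add: power2_sum)
    also have "(sum y S)\<^sup>2 = Y v"
    proof (cases "\<exists>i\<in>S. v \<in> V i")
      case True
      then obtain i where i: "i \<in> S" "v \<in> V i" by auto
      have other: "v \<notin> V j" if "j \<in> S" "j \<noteq> i" for j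
        using V_disj i that by (auto simp: disjoint_family_on_def)
      have "sum y S = (\<Sum>j\<in>S. if j = i then x i else 0)"
        using other i by (intro sum.cong) (auto simp: y_def)
      moreover have "Y v = (\<Sum>j\<in>S. if j = i then (x i)\<^sup>2 else 0)"
        unfolding Y_def using other i by (intro sum.cong) (auto simp: x_def)
      ultimately show ?thesis using i S by simp
    next
      case False
      then have "sum y S = 0" "Y v = 0" by (auto simp: Y_def y_def intro!: sum.neutral)
      then show ?thesis by simp
    qed
    also have "(sum z S)\<^sup>2 \<le> 5 * (\<Sum>i\<in>S. (z i)\<^sup>2)"
      using sum_squared_le_sum_of_squares[of z S] W(3) by simp
    also have "(\<Sum>i\<in>S. (z i)\<^sup>2) \<le> Z v"
      unfolding Z_def
    proof (rule sum_mono)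
      fix i assume "i \<in> S"
      then show "(z i)\<^sup>2 \<le> indicator (U i) (g i *v v) * (f (g i *v v))\<^sup>2"
        using ping_pong[of i v] that by (auto simp: z_def y_def x_def)
    qed
    finally have "(sum x S)\<^sup>2 \<le> 2 * Y v + 10 * Z v" by simp
    have "5 * p0 * a\<^sup>2 = p0 / 5 * (sum x S)\<^sup>2" by (simp add: a_def power2_eq_square)
    also have "\<dots> \<le> p0 / 5 * (2 * Y v + 10 * Z v)"
      using p0 \<open>(sum x S)\<^sup>2 \<le> 2 * Y v + 10 * Z v\<close> by (intro mult_left_mono) auto
    also have "\<dots> = (2 * p0 / 5) * Y v + 2 * p0 * Z v" by (simp add: field_simps)
    finally show ?thesis using jensen unfolding m_def x_def X_def by linarith
  qed
  have X_nonneg: "0 \<le> X v" and Y_nonneg: "0 \<le> Y v" and Z_nonneg: "0 \<le> Z v" for v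
    unfolding X_def Y_def Z_def using w by (auto intro!: sum_nonneg)
  have [measurable]: "X \<in> borel_measurable borel" "Y \<in> borel_measurable borel" "Z \<in> borel_measurable borel"
    unfolding X_def[abs_def] Y_def[abs_def] Z_def[abs_def] by measurable
  have int_f: "(\<integral>\<^sup>+v. ennreal ((f (g i *v v))\<^sup>2) \<partial>lborel) = I" if "i \<in> W" for i
    unfolding I_def using nn_integral_SL2[OF det[OF that], of "\<lambda>v. ennreal ((f v)\<^sup>2)"] by simp
  have int_X: "(\<integral>\<^sup>+v. ennreal (X v) \<partial>lborel) = ennreal (1 - 5 * p0) * I"
  proof -
    have "ennreal (X v) = (\<Sum>i\<in>W. ennreal (w i) * ennreal ((f (g i *v v))\<^sup>2))" for v
      unfolding X_def by (subst sum_ennreal[symmetric]) (auto intro!: sum.cong simp: w ennreal_mult)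
    then have "(\<integral>\<^sup>+v. ennreal (X v) \<partial>lborel)
        = (\<integral>\<^sup>+v. (\<Sum>i\<in>W. ennreal (w i) * ennreal ((f (g i *v v))\<^sup>2)) \<partial>lborel)"
      by simp
    also have "\<dots> = (\<Sum>i\<in>W. ennreal (w i) * I)"
      by (subst nn_integral_sum) (auto simp: nn_integral_cmult int_f)
    also have "\<dots> = ennreal (sum w W) * I"
      using w by (simp add: sum_ennreal flip: sum_distrib_right)
    finally show ?thesis by (simp add: sum_w)
  qed
  have int_Y: "(\<integral>\<^sup>+v. ennreal (Y v) \<partial>lborel) \<le> ennreal 5 * I"
  proof -
    have "(\<integral>\<^sup>+v. ennreal (Y v) \<partial>lborel) \<le> (\<integral>\<^sup>+v. (\<Sum>i\<in>S. ennreal ((f (g i *v v))\<^sup>2)) \<partial>lborel)"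
      unfolding Y_def by (intro nn_integral_mono) (auto simp: sum_ennreal intro!: ennreal_leI sum_mono split: split_indicator)
    also have "\<dots> = (\<Sum>i\<in>S. (\<integral>\<^sup>+v. ennreal ((f (g i *v v))\<^sup>2) \<partial>lborel))"
      by (rule nn_integral_sum) auto
    also have "\<dots> = (\<Sum>i\<in>S. I)"
      using W by (intro sum.cong refl int_f) auto
    finally show ?thesis using W by simp
  qed
  have int_Z: "(\<integral>\<^sup>+v. ennreal (Z v) \<partial>lborel) \<le> I"
  proof -
    have "(\<integral>\<^sup>+v. ennreal (Z v) \<partial>lborel)
        = (\<integral>\<^sup>+v. (\<Sum>i\<in>S. ennreal (indicator (U i) (g i *v v) * (f (g i *v v))\<^sup>2)) \<partial>lborel)"
      by (simp add: Z_def sum_ennreal)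
    also have "\<dots> = (\<Sum>i\<in>S. (\<integral>\<^sup>+v. ennreal (indicator (U i) (g i *v v) * (f (g i *v v))\<^sup>2) \<partial>lborel))"
      by (rule nn_integral_sum) auto
    \<comment> \<open>The substitution by \<open>g i\<close> moves the condition onto
      \<open>v\<close> itself, where disjointness of the sets \<open>U i\<close> makes the five
      integrals add up to at most \<open>I\<close>.\<close>
    also have "\<dots> = (\<Sum>i\<in>S. (\<integral>\<^sup>+v. ennreal (indicator (U i) v * (f v)\<^sup>2) \<partial>lborel))"
      using W det by (intro sum.cong refl nn_integral_SL2[of _ "\<lambda>v. ennreal (indicator (U _) v * (f v)\<^sup>2)"]) auto
    also have "\<dots> = (\<integral>\<^sup>+v. (\<Sum>i\<in>S. ennreal (indicator (U i) v * (f v)\<^sup>2)) \<partial>lborel)"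
      by (rule nn_integral_sum[symmetric]) auto
    also have "\<dots> \<le> I"
      unfolding I_def
    proof (intro nn_integral_mono)
      fix v
      have "(\<Sum>i\<in>S. indicator (U i) v) = (indicator (\<Union>i\<in>S. U i) v :: real)"
        by (rule indicator_UN_disjoint[symmetric]) (auto simp: S U_disj)
      then have "(\<Sum>i\<in>S. indicator (U i) v * (f v)\<^sup>2) \<le> (f v)\<^sup>2"
        by (auto simp flip: sum_distrib_right split: split_indicator)
      then show "(\<Sum>i\<in>S. ennreal (indicator (U i) v * (f v)\<^sup>2)) \<le> ennreal ((f v)\<^sup>2)"
        by (simp add: sum_ennreal ennreal_leI)
    qed
    finally show ?thesis .
  qed
  have p0_le: "5 * p0 \<le> 1" using sum_w w by (metis diff_ge_0_iff_ge sum_nonneg)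
  have "(\<integral>\<^sup>+v. ennreal ((\<Sum>i\<in>W. p i * f (g i *v v))\<^sup>2) \<partial>lborel)
      \<le> (\<integral>\<^sup>+v. ennreal (X v) + (ennreal (2 * p0 / 5) * ennreal (Y v) + ennreal (2 * p0) * ennreal (Z v)) \<partial>lborel)"
  proof (rule nn_integral_mono_AE)
    have "AE v in lborel. v \<noteq> (0 :: real^2)"
      by (rule AE_I'[of "{0}"]) auto
    then show "AE v in lborel. ennreal ((\<Sum>i\<in>W. p i * f (g i *v v))\<^sup>2)
        \<le> ennreal (X v) + (ennreal (2 * p0 / 5) * ennreal (Y v) + ennreal (2 * p0) * ennreal (Z v))"
    proof eventually_elim
      case (elim v)
      then show ?case using pointwise[of v] X_nonneg Y_nonneg Z_nonneg p0
        by (simp add: add.assoc ennreal_leI flip: ennreal_mult ennreal_plus)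
    qed
  qed
  also have "\<dots> = (\<integral>\<^sup>+v. ennreal (X v) \<partial>lborel) + (ennreal (2 * p0 / 5) * (\<integral>\<^sup>+v. ennreal (Y v) \<partial>lborel)
      + ennreal (2 * p0) * (\<integral>\<^sup>+v. ennreal (Z v) \<partial>lborel))"
    by (simp add: nn_integral_add nn_integral_cmult)
  also have "\<dots> \<le> ennreal (1 - 5 * p0) * I + (ennreal (2 * p0 / 5) * (ennreal 5 * I) + ennreal (2 * p0) * I)"
    unfolding int_X by (intro add_mono mult_left_mono int_Y int_Z order_refl) auto
  \<comment> \<open>With \<open>k\<close> words in \<open>S\<close> the factor would be
    \<open>1 - k * p0 + 4 * p0\<close>; five is the least \<open>k\<close> for which this
    contracts.\<close>
  also have "\<dots> = ennreal (1 - p0) * I"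
  proof -
    have "ennreal (2 * p0 / 5) * ennreal 5 = ennreal (2 * p0)"
      using p0 by (subst ennreal_mult[symmetric]) auto
    moreover have "ennreal (1 - 5 * p0) + (ennreal (2 * p0) + ennreal (2 * p0)) = ennreal (1 - p0)"
      using p0 p0_le by (simp flip: ennreal_plus)
    ultimately show ?thesis by (simp only: mult.assoc[symmetric] distrib_right[symmetric])
  qed
  finally show ?thesis by (simp add: I_def)
qed

section \<open>Markov operators and sums over words\<close>

definition avg :: "('i::finite \<Rightarrow> real) \<Rightarrow> ('i \<Rightarrow> real^2^2) \<Rightarrow> (real^2 \<Rightarrow> real) \<Rightarrow> real^2 \<Rightarrow> real" where
  "avg p M f v = (\<Sum>i\<in>UNIV. p i * f (M i *v v))"

lemma finite_words: "finite {w :: 'i::finite list. length w = n}"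
  using finite_lists_length_eq[of "UNIV :: 'i set" n] by simp

lemma sum_words_Suc:
  fixes h :: "'i::finite list \<Rightarrow> 'b::comm_monoid_add"
  shows "(\<Sum>w | length w = Suc n. h w) = (\<Sum>i\<in>UNIV. \<Sum>w | length w = n. h (i # w))"
proof -
  have "(\<Sum>w | length w = Suc n. h w) = (\<Sum>(i, w)\<in>UNIV \<times> {w. length w = n}. h (i # w))"
    by (rule sum.reindex_bij_witness[of _ "\<lambda>(i, w). i # w" "\<lambda>w. (hd w, tl w)"])
      (auto simp: length_Suc_conv)
  then show ?thesis by (simp add: sum.cartesian_product)
qed

lemma funpow_avg:
  "(avg p M ^^ n) f v = (\<Sum>w | length w = n. prod_list (map p w) * f (wprod M w *v v))"
proof (induction n arbitrary: v)
  case (Suc n)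
  have "(avg p M ^^ Suc n) f v = (\<Sum>i\<in>UNIV. p i * (avg p M ^^ n) f (M i *v v))"
    by (simp add: avg_def)
  then show ?case
    by (simp add: Suc sum_words_Suc sum_distrib_left mult.assoc matrix_vector_mul_assoc)
qed simp

lemma sum_prod_list:
  fixes p :: "'i::finite \<Rightarrow> real"
  assumes "sum p UNIV = 1"
  shows "(\<Sum>w | length w = n. prod_list (map p w)) = 1"
  by (induction n) (simp_all add: sum_words_Suc assms flip: sum_distrib_left)

lemma measurable_funpow_avg:
  assumes [measurable]: "f \<in> borel_measurable borel"
  shows "(avg p M ^^ n) f \<in> borel_measurable borel"
proof -
  have [measurable]: "(\<lambda>v. M *v v) \<in> borel_measurable borel" for M :: "real^2^2"
    by (intro borel_measurable_continuous_onI continuous_intros)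
  show ?thesis unfolding funpow_avg[abs_def] by measurable
qed

section \<open>Ping-pong\<close>

text \<open>A double cone about the line through \<open>u\<close>, punctured at the origin. As
  \<open>u\<close> is not normalised, the sine of the angle is bounded by
  \<open>\<delta> / norm u\<close> when \<open>u\<close> is nonzero.\<close>

definition cone :: "real^2 \<Rightarrow> real \<Rightarrow> (real^2) set" where
  "cone u \<delta> = {v. v \<noteq> 0 \<and> \<bar>cross2 u v\<bar> < \<delta> * norm v}"

lemma cross2_add_right: "cross2 u (v + w) = cross2 u v + cross2 u w"
  by (simp add: cross2_def algebra_simps)

lemma cross2_scaleR_right: "cross2 u (c *\<^sub>R v) = c * cross2 u v"
  by (simp add: cross2_def algebra_simps)

lemma cross2_self [simp]: "cross2 u u = 0"
  by (simp add: cross2_def)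

lemma borel_cone [measurable]: "cone u \<delta> \<in> sets borel"
proof -
  have "open (cone u \<delta>)"
    unfolding cone_def cross2_def
    by (intro open_Collect_conj open_Collect_neq open_Collect_less continuous_intros)
  then show ?thesis by simp
qed

text \<open>Cramer's rule expresses \<open>cross2 u w *\<^sub>R v\<close> through
  \<open>cross2 u v\<close> and \<open>cross2 w v\<close>; for a vector \<open>v\<close> common to
  both cones these two are too small.\<close>

lemma cone_disjoint:
  assumes "cross2 u w \<noteq> 0" "\<delta> * (norm u + norm w) \<le> \<bar>cross2 u w\<bar>"
  shows "cone u \<delta> \<inter> cone w \<delta> = {}"
proof (rule ccontr)
  assume "cone u \<delta> \<inter> cone w \<delta> \<noteq> {}"
  then obtain v where v: "v \<noteq> 0" "\<bar>cross2 u v\<bar> < \<delta> * norm v" "\<bar>cross2 w v\<bar> < \<delta> * norm v"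
    by (auto simp: cone_def)
  have uw: "u \<noteq> 0" "w \<noteq> 0" using assms by (auto simp: cross2_def)
  have "cross2 u w *\<^sub>R v = cross2 u v *\<^sub>R w - cross2 w v *\<^sub>R u"
    by (vector cross2_def) (simp add: forall_2 cross2_def algebra_simps)
  then have "\<bar>cross2 u w\<bar> * norm v = norm (cross2 u v *\<^sub>R w - cross2 w v *\<^sub>R u)"
    by (metis norm_scaleR)
  also have "\<dots> \<le> \<bar>cross2 u v\<bar> * norm w + \<bar>cross2 w v\<bar> * norm u"
    by (rule order_trans[OF norm_triangle_ineq4]) simp
  also have "\<dots> < \<delta> * norm v * norm w + \<delta> * norm v * norm u"
    using v uw by (intro add_strict_mono mult_strict_right_mono) auto
  also have "\<dots> = \<delta> * (norm u + norm w) * norm v" by (simp add: algebra_simps)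
  also have "\<dots> \<le> \<bar>cross2 u w\<bar> * norm v" using assms by (intro mult_right_mono) auto
  finally show False by simp
qed

lemma cones_disjoint_ev:
  assumes "finite S" and "\<And>i j. i \<in> S \<Longrightarrow> j \<in> S \<Longrightarrow> i \<noteq> j \<Longrightarrow> cross2 (u i) (u j) \<noteq> 0"
  shows "\<forall>\<^sub>F \<delta> in at_right 0. disjoint_family_on (\<lambda>i. cone (u i) \<delta>) S"
proof -
  have "\<forall>\<^sub>F \<delta> in at_right 0. cone (u i) \<delta> \<inter> cone (u j) \<delta> = {}"
    if "i \<in> S" "j \<in> S" "i \<noteq> j" for i j
  proof -
    have "((\<lambda>\<delta>. \<delta> * (norm (u i) + norm (u j))) \<longlongrightarrow> 0 * (norm (u i) + norm (u j))) (at_right 0)"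
      by (intro tendsto_intros)
    then have "\<forall>\<^sub>F \<delta> in at_right 0. \<delta> * (norm (u i) + norm (u j)) < \<bar>cross2 (u i) (u j)\<bar>"
      using assms(2)[OF that] by (intro order_tendstoD(2)) auto
    then show ?thesis by eventually_elim (rule cone_disjoint[OF assms(2)[OF that]], simp)
  qed
  then have "\<forall>\<^sub>F \<delta> in at_right 0. i \<noteq> j \<longrightarrow> cone (u i) \<delta> \<inter> cone (u j) \<delta> = {}"
    if "i \<in> S" "j \<in> S" for i j
    using that by (cases "i = j") auto
  then have "\<forall>\<^sub>F \<delta> in at_right 0. \<forall>i\<in>S. \<forall>j\<in>S. i \<noteq> j \<longrightarrow> cone (u i) \<delta> \<inter> cone (u j) \<delta> = {}"
    using assms(1) by (simp add: eventually_ball_finite)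
  then show ?thesis by eventually_elim (auto simp: disjoint_family_on_def)
qed

text \<open>\<open>k\<close> spans the kernel and \<open>u\<close> the image. Writing the functional
  as \<open>cross2 k\<close> lets matrices of determinant one move the kernel direction, by
  \<open>cross2_mult\<close>.\<close>

lemma singular_matrix_rank_one:
  fixes R :: "real^2^2"
  assumes "det R = 0" "R \<noteq> 0"
  obtains k u where "k \<noteq> 0" "u \<noteq> 0" "\<And>v. R *v v = cross2 k v *\<^sub>R u"
proof -
  have det: "R$1$1 * R$2$2 = R$1$2 * R$2$1" using assms by (simp add: det_2)
  show ?thesis
  proof (cases "R$1 = 0")
    case True
    then have "R$2 \<noteq> 0" using assms by (auto simp: vec_eq_iff forall_2)
    then show ?thesis using True
      by (intro that[of "vector [R$2$2, - (R$2$1)]" "vector [0, 1]"])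
        (auto simp: vec_eq_iff forall_2 cross2_def matrix_vector_mult_def UNIV_2)
  next
    case False
    define t where "t = (if R$1$1 \<noteq> 0 then R$2$1 / R$1$1 else R$2$2 / R$1$2)"
    have t: "R$2$1 = t * R$1$1" "R$2$2 = t * R$1$2"
      using det False by (auto simp: t_def vec_eq_iff forall_2 field_simps)
    show ?thesis using False t
      by (intro that[of "vector [R$1$2, - (R$1$1)]" "vector [1, t]"])
        (auto simp: vec_eq_iff forall_2 cross2_def matrix_vector_mult_def UNIV_2 algebra_simps)
  qed
qed

lemma op_norm_le_norm: "op_norm (M :: real^2^2) \<le> 4 * norm M"
proof -
  have "\<bar>M $ i $ j\<bar> \<le> norm M" for i j
    by (meson component_le_norm_cart Finite_Cartesian_Product.norm_nth_le order_trans)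
  then show ?thesis
    unfolding op_norm_def using onorm_le_matrix_component[of M "norm M"] by simp
qed

text \<open>For large \<open>n\<close> the matrix \<open>G n\<close> is, up to scale, the rank one
  matrix \<open>R\<close> plus a small error. Since \<open>R ** Q\<close> has kernel direction
  \<open>k\<close>, it sends a vector away from \<open>k\<close> to a multiple of \<open>u\<close>
  that dominates the error, and \<open>P\<close> then brings it close to \<open>P *v u\<close>. The
  argument runs by contraposition.\<close>

lemma cone_mapping_ev:
  fixes G :: "nat \<Rightarrow> real^2^2"
  assumes lim: "(\<lambda>n. (1 / norm (G n)) *\<^sub>R G n) \<longlonglongrightarrow> R"
    and G: "\<And>n. G n \<noteq> 0"
    and R: "\<And>v. R *v v = cross2 (Q *v k) v *\<^sub>R u" and Q: "det Q = 1" and P: "P *v u \<noteq> 0" and "\<delta> > 0"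
  shows "\<forall>\<^sub>F n in sequentially. \<forall>v. v \<noteq> 0 \<longrightarrow> v \<in> cone k \<delta> \<or> (P ** G n ** Q) *v v \<in> cone (P *v u) \<delta>"
proof -
  define E where "E n = (1 / norm (G n)) *\<^sub>R G n - R" for n
  define \<eta> where "\<eta> n = op_norm P * op_norm (E n) * op_norm Q" for n
  let ?u = "P *v u"
  have "(\<lambda>n. norm (E n)) \<longlonglongrightarrow> 0"
    using lim unfolding E_def by (simp add: LIM_zero tendsto_norm_zero)
  then have "(\<lambda>n. 4 * norm (E n)) \<longlonglongrightarrow> 0" by (auto intro: tendsto_eq_intros)
  then have "(\<lambda>n. op_norm (E n)) \<longlonglongrightarrow> 0"
    by (rule tendsto_sandwich[rotated 3]) (auto simp: op_norm_le_norm)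
  then have "(\<lambda>n. norm ?u * \<eta> n + \<delta> * \<eta> n) \<longlonglongrightarrow> 0"
    unfolding \<eta>_def by (auto intro!: tendsto_eq_intros)
  then have "\<forall>\<^sub>F n in sequentially. norm ?u * \<eta> n + \<delta> * \<eta> n < \<delta> * \<delta> * norm ?u"
    using P \<open>\<delta> > 0\<close> by (intro order_tendstoD(2)) auto
  then show ?thesis
  proof (eventually_elim, safe)
    fix n v assume ev: "norm ?u * \<eta> n + \<delta> * \<eta> n < \<delta> * \<delta> * norm ?u"
      and v: "v \<noteq> 0" and notin: "(P ** G n ** Q) *v v \<notin> cone ?u \<delta>"
    define e where "e = P *v (E n *v (Q *v v))"
    define y where "y = cross2 k v *\<^sub>R ?u + e"
    have e: "norm e \<le> \<eta> n * norm v"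
    proof -
      have "norm e \<le> op_norm P * (op_norm (E n) * (op_norm Q * norm v))"
        unfolding e_def
        by (intro order_trans[OF norm_mult_op_norm] mult_left_mono order_refl) auto
      then show ?thesis by (simp add: \<eta>_def mult.assoc)
    qed
    have cr_k: "cross2 (Q *v k) (Q *v v) = cross2 k v" using Q by (simp add: cross2_mult)
    have "G n = norm (G n) *\<^sub>R (R + E n)" using G by (simp add: E_def)
    then have "(P ** G n ** Q) *v v = norm (G n) *\<^sub>R (P *v (R *v (Q *v v)) + e)"
      unfolding e_def
      by (metis (no_types, lifting) matrix_vector_mul_assoc matrix_vector_mult_add_rdistrib
          matrix_vector_right_distrib matrix_vector_mult_scaleR scaleR_matrix_vector_assoc)
    then have "(P ** G n ** Q) *v v = norm (G n) *\<^sub>R y"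
      by (simp add: R cr_k y_def matrix_vector_mult_scaleR)
    with notin have y: "y = 0 \<or> \<delta> * norm y \<le> \<bar>cross2 ?u y\<bar>"
      using G[of n] by (auto simp: cone_def cross2_scaleR_right abs_mult not_less algebra_simps)
    \<comment> \<open>The main part of \<open>y\<close> is parallel to \<open>?u\<close> and drops
      out, so outside the cone even \<open>norm y\<close> is of the order of the error.\<close>
    have "\<bar>cross2 ?u y\<bar> = \<bar>cross2 ?u e\<bar>" by (simp add: y_def cross2_add_right cross2_scaleR_right)
    also have "\<dots> \<le> norm ?u * (\<eta> n * norm v)"
      by (rule order_trans[OF abs_cross2_le]) (intro mult_left_mono e norm_ge_zero)
    finally have cr_y: "\<bar>cross2 ?u y\<bar> \<le> norm ?u * (\<eta> n * norm v)" .
    have "\<bar>cross2 k v\<bar> * norm ?u \<le> norm y + norm e"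
      using norm_triangle_ineq4[of y e] by (simp add: y_def)
    then have "\<delta> * (\<bar>cross2 k v\<bar> * norm ?u) \<le> \<delta> * (norm y + norm e)"
      using \<open>\<delta> > 0\<close> by (intro mult_left_mono) auto
    also have "\<dots> = \<delta> * norm y + \<delta> * norm e" by (simp add: algebra_simps)
    also have "\<dots> \<le> norm ?u * (\<eta> n * norm v) + \<delta> * (\<eta> n * norm v)"
      using y cr_y e \<open>\<delta> > 0\<close> by (intro add_mono mult_left_mono) auto
    also have "\<dots> = (norm ?u * \<eta> n + \<delta> * \<eta> n) * norm v" by (simp add: algebra_simps)
    also have "\<dots> < \<delta> * \<delta> * norm ?u * norm v" using ev v by (intro mult_strict_right_mono) auto
    finally have "(\<delta> * norm ?u) * \<bar>cross2 k v\<bar> < (\<delta> * norm ?u) * (\<delta> * norm v)" by (simp add: algebra_simps)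
    then have "\<bar>cross2 k v\<bar> < \<delta> * norm v"
      using P \<open>\<delta> > 0\<close> by (subst (asm) mult_less_cancel_left_pos) auto
    then show "v \<in> cone k \<delta>" using v by (simp add: cone_def)
  qed
qed

section \<open>Orbits on the projective line\<close>

lemma span_singleton_projective_line: "v \<noteq> 0 \<Longrightarrow> span {v :: real^2} \<in> projective_line"
  by (simp add: projective_line_def)

lemma proj_action_span: "proj_action M (span {v}) = span {M *v v}"
  unfolding proj_action_def
  using linear_span_image[of "\<lambda>v. M *v v" "{v}"] by simp

lemma mult_SL2_nonzero: "det M = 1 \<Longrightarrow> v \<noteq> 0 \<Longrightarrow> M *v v \<noteq> (0 :: real^2)"
proof
  assume "det M = 1" "v \<noteq> 0" "M *v v = 0"
  then have "matrix_inv M *v (M *v v) = 0" by simp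
  then show False using \<open>v \<noteq> 0\<close> \<open>det M = 1\<close> by (simp add: matrix_vector_mul_assoc matrix_inv_SL2)
qed

lemma inj_proj_action: "det M = 1 \<Longrightarrow> inj (proj_action M)"
proof (rule inj_on_inverseI)
  fix V assume "det M = 1"
  then show "proj_action (matrix_inv M) (proj_action M V) = V"
    by (simp add: proj_action_def image_image matrix_vector_mul_assoc matrix_inv_SL2)
qed

text \<open>A matrix and its inverse permute the same finite sets of lines. The inverses serve to
  spread out the repelling directions, which are pulled back.\<close>

lemma strongly_irreducible_matrix_inv:
  assumes "strongly_irreducible S A" "\<And>i. i \<in> S \<Longrightarrow> A i \<in> SL2"
  shows "strongly_irreducible S (\<lambda>i. matrix_inv (A i))"
proof -
  have "proj_action (A i) ` L = L" if "i \<in> S" "proj_action (matrix_inv (A i)) ` L = L" for i L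
  proof -
    have "proj_action (A i) ` (proj_action (matrix_inv (A i)) ` L) = L"
      using assms(2)[OF that(1)]
      by (simp add: proj_action_def image_image matrix_vector_mul_assoc matrix_inv_SL2 SL2_def)
    then show ?thesis using that(2) by simp
  qed
  then show ?thesis using assms(1) unfolding strongly_irreducible_def by metis
qed

text \<open>A finite orbit would be mapped into itself by every letter, hence onto itself by
  injectivity, contradicting strong irreducibility.\<close>

lemma infinite_orbit:
  assumes irr: "strongly_irreducible S A" and SL2: "\<And>i. i \<in> S \<Longrightarrow> A i \<in> SL2" and "v \<noteq> 0"
  shows "infinite ((\<lambda>w. span {wprod A w *v v}) ` lists S)"
proof
  let ?L = "(\<lambda>w. span {wprod A w *v v}) ` lists S"
  assume fin: "finite ?L"
  have "proj_action (A i) ` ?L = ?L" if "i \<in> S" for i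
  proof (rule endo_inj_surj[OF fin])
    show "proj_action (A i) ` ?L \<subseteq> ?L"
    proof (intro image_subsetI)
      fix V assume "V \<in> ?L"
      then obtain w where w: "w \<in> lists S" and V: "V = span {wprod A w *v v}" by blast
      have "proj_action (A i) (span {wprod A w *v v}) = span {wprod A (w @ [i]) *v v}"
        by (simp add: proj_action_span wprod_append matrix_vector_mul_assoc)
      moreover have "w @ [i] \<in> lists S" using w that by simp
      ultimately show "proj_action (A i) V \<in> ?L" unfolding V by (intro image_eqI)
    qed
    show "inj_on (proj_action (A i)) ?L"
      using inj_proj_action[of "A i"] SL2[OF that] by (auto simp: SL2_def intro: inj_on_subset)
  qed
  moreover have "?L \<subseteq> projective_line"
  proof (intro image_subsetI span_singleton_projective_line mult_SL2_nonzero det_wprod)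
    show "A i \<in> SL2" if "w \<in> lists S" "i \<in> set w" for w i using that SL2 by auto
  qed (rule \<open>v \<noteq> 0\<close>)
  moreover have "?L \<noteq> {}" by auto
  ultimately have "\<exists>L. L \<subseteq> projective_line \<and> finite L \<and> L \<noteq> {} \<and> (\<forall>i\<in>S. proj_action (A i) ` L = L)"
    using fin by (intro exI[of _ ?L] conjI ballI)
  then show False using irr by (simp add: strongly_irreducible_def)
qed

lemma cross2_eq_0_imp_span_eq:
  assumes "cross2 u v = 0" "u \<noteq> 0" "v \<noteq> 0"
  shows "span {u} = span {v}"
proof -
  have "\<exists>c. c \<noteq> 0 \<and> v = c *\<^sub>R u"
  proof (cases "u$1 = 0")
    case True
    then have "u$2 \<noteq> 0" using assms by (auto simp: vec_eq_iff forall_2)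
    then show ?thesis using True assms
      by (intro exI[of _ "v$2 / u$2"]) (auto simp: vec_eq_iff forall_2 cross2_def)
  next
    case False
    then show ?thesis using assms
      by (intro exI[of _ "v$1 / u$1"]) (auto simp: vec_eq_iff forall_2 cross2_def field_simps)
  qed
  then obtain c where c: "c \<noteq> 0" "v = c *\<^sub>R u" by blast
  then have "u = (1 / c) *\<^sub>R v" by simp
  then show ?thesis unfolding span_eq using c(2) by (metis empty_subsetI insert_subset span_base span_scale insertI1)
qed

lemma independent_orbit_points:
  assumes "strongly_irreducible S A" "\<And>i. i \<in> S \<Longrightarrow> A i \<in> SL2" "v \<noteq> 0"
  shows "\<exists>a :: nat \<Rightarrow> 's list. (\<forall>j. a j \<in> lists S) \<and>
    (\<forall>i j. i \<noteq> j \<longrightarrow> cross2 (wprod A (a i) *v v) (wprod A (a j) *v v) \<noteq> 0)"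
proof -
  obtain h :: "nat \<Rightarrow> (real^2) set" where h: "inj h" "range h \<subseteq> (\<lambda>w. span {wprod A w *v v}) ` lists S"
    using infinite_countable_subset[OF infinite_orbit[OF assms]] by blast
  then have "\<forall>j. \<exists>w. w \<in> lists S \<and> h j = span {wprod A w *v v}" by blast
  then obtain a where a: "\<And>j. a j \<in> lists S" "\<And>j. h j = span {wprod A (a j) *v v}" by metis
  have "wprod A (a j) *v v \<noteq> 0" for j
    using a(1)[of j] assms(2,3) by (intro mult_SL2_nonzero det_wprod) auto
  then have "i = j" if "cross2 (wprod A (a i) *v v) (wprod A (a j) *v v) = 0" for i j
    using cross2_eq_0_imp_span_eq[OF that] h(1) by (simp add: inj_eq flip: a(2))
  then show ?thesis using a(1) by (intro exI[of _ a]) blast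
qed

text \<open>Inverse letters may lie outside the semigroup, yet the repelling directions are placed
  by them. The reversed word gives an element of the semigroup that undoes such a product.\<close>

lemma wprod_rev_inverse:
  assumes "\<And>i. i \<in> set w \<Longrightarrow> A i \<in> SL2"
  shows "wprod A (rev w) ** wprod (\<lambda>i. matrix_inv (A i)) w = mat 1"
  using assms
proof (induction w)
  case (Cons i w)
  have "wprod A (rev (i # w)) ** wprod (\<lambda>i. matrix_inv (A i)) (i # w)
      = A i ** (wprod A (rev w) ** wprod (\<lambda>i. matrix_inv (A i)) w) ** matrix_inv (A i)"
    by (simp add: wprod_append matrix_mul_assoc)
  then show ?case using Cons by (simp add: matrix_inv_SL2 SL2_def)
qed simp

text \<open>Normalised products of growing norm accumulate at a matrix \<open>R\<close> of rank one,
  singular because the determinant 1 is divided by the squared norm. Some long product acts almost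
  like \<open>R\<close>, repelling from \<open>k\<close> and attracting to \<open>u\<close>.
  Precomposing with \<open>rev (b j)\<close> and postcomposing with \<open>a j\<close> moves these
  directions to pairwise distinct lines through \<open>k' j\<close> and \<open>u' j\<close>, which
  exist because orbits of lines are infinite.\<close>

lemma ping_pong_words:
  fixes A :: "'s \<Rightarrow> real^2^2"
  assumes irr: "strongly_irreducible S A" and SL2: "\<And>i. i \<in> S \<Longrightarrow> A i \<in> SL2"
    and unbounded: "\<And>C. \<exists>w\<in>lists S. C < op_norm (wprod A w)"
  obtains s :: "nat \<Rightarrow> 's list" and U V where "\<And>j. s j \<in> lists S"
    "\<And>j. U j \<in> sets borel" "\<And>j. V j \<in> sets borel"
    "disjoint_family_on U {..<5::nat}" "disjoint_family_on V {..<5}"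
    "\<And>j v. j < 5 \<Longrightarrow> v \<noteq> 0 \<Longrightarrow> v \<in> V j \<or> wprod A (s j) *v v \<in> U j"
    "inj_on (\<lambda>j. wprod A (s j)) {..<5}"
proof -
  have det_w: "det (wprod A w) = 1" if "w \<in> lists S" for w
    using that SL2 by (intro det_wprod) auto
  have "\<exists>w\<in>lists S. real (Suc n) < norm (wprod A w)" for n
    using unbounded[of "4 * real (Suc n)"] op_norm_le_norm by (metis (no_types, lifting) mult_less_cancel_left_pos order_less_le_trans zero_less_numeral)
  then obtain g where g: "\<And>n. g n \<in> lists S" "\<And>n. real (Suc n) < norm (wprod A (g n))" by metis
  define H where "H n = (1 / norm (wprod A (g n))) *\<^sub>R wprod A (g n)" for n
  have pos: "0 < norm (wprod A (g n))" for n using g(2)[of n] by linarith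
  have "H n \<in> sphere 0 1" for n using pos[of n] by (simp add: H_def)
  then obtain R r where R: "R \<in> sphere 0 1" and r: "strict_mono r" "(H \<circ> r) \<longlonglongrightarrow> R"
    using compact_sphere[of "0 :: real^2^2" 1] unfolding compact_def by metis
  have "det R = 0"
  proof -
    have det_lim: "(\<lambda>n. det ((H \<circ> r) n)) \<longlonglongrightarrow> det R"
      unfolding det_2 using r(2) by (intro tendsto_intros)
    have "(\<lambda>n. det (H n)) \<longlonglongrightarrow> 0"
    proof (rule tendsto_sandwich[OF _ _ tendsto_const lim_const_over_n[of 1]])
      have det_H: "det (H n) = 1 / (norm (wprod A (g n)))\<^sup>2" for n
        using det_w[OF g(1)[of n]] unfolding H_def det_2 
        by (simp add: power2_eq_square flip: diff_divide_distrib)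
      show "\<forall>\<^sub>F n in sequentially. 0 \<le> det (H n)" by (simp add: det_H)
      show "\<forall>\<^sub>F n in sequentially. det (H n) \<le> 1 / real n"
        using eventually_gt_at_top[of 0]
      proof eventually_elim
        case (elim n)
        have "real n * 1 \<le> norm (wprod A (g n)) * norm (wprod A (g n))"
          using g(2)[of n] by (intro mult_mono) auto
        then show ?case using elim by (simp add: det_H power2_eq_square frac_le)
      qed
    qed
    then have "((\<lambda>n. det (H n)) \<circ> r) \<longlonglongrightarrow> 0" using r(1) by (rule LIMSEQ_subseq_LIMSEQ)
    then show ?thesis using det_lim by (auto simp: comp_def intro: LIMSEQ_unique)
  qed
  moreover have "R \<noteq> 0" using R by auto
  ultimately obtain k u where ku: "k \<noteq> 0" "u \<noteq> 0" and Rv: "\<And>v. R *v v = cross2 k v *\<^sub>R u"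
    using singular_matrix_rank_one by blast
  obtain a :: "nat \<Rightarrow> 's list" where a: "\<And>j. a j \<in> lists S"
      "\<And>i j. i \<noteq> j \<Longrightarrow> cross2 (wprod A (a i) *v u) (wprod A (a j) *v u) \<noteq> 0"
    using independent_orbit_points[OF irr _ ku(2)] SL2 by blast
  define A' where "A' = (\<lambda>i. matrix_inv (A i))"
  have irr': "strongly_irreducible S A'"
    unfolding A'_def using irr SL2 by (rule strongly_irreducible_matrix_inv)
  have SL2': "A' i \<in> SL2" if "i \<in> S" for i
    using matrix_inv_SL2(3)[of "A i"] SL2[OF that] by (simp add: SL2_def A'_def)
  obtain b :: "nat \<Rightarrow> 's list" where b: "\<And>j. b j \<in> lists S"
      "\<And>i j. i \<noteq> j \<Longrightarrow> cross2 (wprod A' (b i) *v k) (wprod A' (b j) *v k) \<noteq> 0"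
    using independent_orbit_points[OF irr' _ ku(1)] SL2' by blast
  define u' where "u' j = wprod A (a j) *v u" for j
  define k' where "k' j = wprod A' (b j) *v k" for j
  have "\<forall>\<^sub>F \<delta> in at_right 0. disjoint_family_on (\<lambda>i. cone (u' i) \<delta>) {..<5}"
    by (rule cones_disjoint_ev) (auto simp: u'_def a)
  moreover have "\<forall>\<^sub>F \<delta> in at_right 0. disjoint_family_on (\<lambda>i. cone (k' i) \<delta>) {..<5}"
    by (rule cones_disjoint_ev) (auto simp: k'_def b)
  moreover have "\<forall>\<^sub>F \<delta> in at_right 0. 0 < (\<delta> :: real)" by (rule eventually_at_right_less)
  ultimately have "\<forall>\<^sub>F \<delta> in at_right (0::real). disjoint_family_on (\<lambda>i. cone (u' i) \<delta>) {..<5} \<and>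
      disjoint_family_on (\<lambda>i. cone (k' i) \<delta>) {..<5} \<and> 0 < \<delta>"
    by eventually_elim auto
  then obtain \<delta> where \<delta>: "disjoint_family_on (\<lambda>i. cone (u' i) \<delta>) {..<5}"
      "disjoint_family_on (\<lambda>i. cone (k' i) \<delta>) {..<5}" "0 < \<delta>"
    using eventually_happens'[OF trivial_limit_at_right_real] by blast
  let ?s = "\<lambda>n j. rev (b j) @ g (r n) @ a j"
  have "\<forall>\<^sub>F n in sequentially. \<forall>v. v \<noteq> 0 \<longrightarrow> v \<in> cone (k' j) \<delta> \<or> wprod A (?s n j) *v v \<in> cone (u' j) \<delta>" for j
  proof -
    have "wprod A (rev (b j)) *v k' j = k"
      using b(1)[of j] SL2 wprod_rev_inverse[of "b j" A]
      by (auto simp: k'_def A'_def matrix_vector_mul_assoc)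
    then have "\<forall>\<^sub>F n in sequentially. \<forall>v. v \<noteq> 0 \<longrightarrow> v \<in> cone (k' j) \<delta> \<or>
        (wprod A (a j) ** wprod A (g (r n)) ** wprod A (rev (b j))) *v v \<in> cone (wprod A (a j) *v u) \<delta>"
    proof (intro cone_mapping_ev)
      show "(\<lambda>n. (1 / norm (wprod A (g (r n)))) *\<^sub>R wprod A (g (r n))) \<longlonglongrightarrow> R"
        using r(2) by (simp add: H_def comp_def)
      show "wprod A (g (r n)) \<noteq> 0" for n using pos[of "r n"] by auto
      show "det (wprod A (rev (b j))) = 1" using b(1)[of j] by (intro det_w) auto
      show "wprod A (a j) *v u \<noteq> 0" using a(1) ku(2) by (intro mult_SL2_nonzero det_w)
    qed (use Rv \<delta> in auto)
    then show ?thesis by (simp add: wprod_append u'_def)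
  qed
  then have "\<forall>\<^sub>F n in sequentially. \<forall>j\<in>{..<5}. \<forall>v. v \<noteq> 0 \<longrightarrow> v \<in> cone (k' j) \<delta> \<or> wprod A (?s n j) *v v \<in> cone (u' j) \<delta>"
    by (intro eventually_ball_finite) auto
  then obtain n where n: "\<forall>j\<in>{..<5}. \<forall>v. v \<noteq> 0 \<longrightarrow> v \<in> cone (k' j) \<delta> \<or> wprod A (?s n j) *v v \<in> cone (u' j) \<delta>"
    by (auto simp: eventually_sequentially)
  \<comment> \<open>A third index \<open>l\<close> separates the products: \<open>k' l\<close>
    avoids the cones at \<open>k' i\<close> and \<open>k' j\<close>, so equal products would send it
    into two disjoint cones.\<close>
  have inj: "inj_on (\<lambda>j. wprod A (?s n j)) {..<5}"
  proof (rule inj_onI, rule ccontr)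
    fix i j assume ij: "i \<in> {..<5}" "j \<in> {..<5}" "wprod A (?s n i) = wprod A (?s n j)" "i \<noteq> j"
    have "card ({..<5} - {i, j}) = 3" using ij by (simp add: card_Diff_subset)
    then have "{..<5} - {i, j} \<noteq> {}" by (metis card.empty zero_neq_numeral)
    then obtain l where l: "l < 5" "l \<noteq> i" "l \<noteq> j" by blast
    have "k' l \<noteq> 0" using b(2)[of l i] l by (auto simp: k'_def cross2_def)
    moreover from this have "k' l \<in> cone (k' l) \<delta>" using \<delta> by (simp add: cone_def)
    then have "k' l \<notin> cone (k' i) \<delta>" "k' l \<notin> cone (k' j) \<delta>"
      using \<delta>(2) l ij by (auto simp: disjoint_family_on_def)
    ultimately have "wprod A (?s n i) *v k' l \<in> cone (u' i) \<delta> \<inter> cone (u' j) \<delta>"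
      using n ij by fastforce
    then show False using \<delta>(1) ij by (auto simp: disjoint_family_on_def)
  qed
  have "?s n j \<in> lists S" for j using a(1)[of j] b(1)[of j] g(1)[of "r n"] by auto
  then show ?thesis
    by (rule that[of "?s n" "\<lambda>j. cone (u' j) \<delta>" "\<lambda>j. cone (k' j) \<delta>"])
      (use n \<delta> inj in auto)
qed

section \<open>Boundedness of the generated semigroup\<close>

lemma prob_prefix_eq:
  fixes q :: "'s::finite pmf"
  assumes "length w = n"
  shows "measure (bernoulli_nat q) {x. map x [0..<n] = w} = prod_list (map (pmf q) w)"
proof -
  interpret product_prob_space "\<lambda>_::nat. measure_pmf q" UNIV
    by unfold_locales
  have "{x. map x [0..<n] = w} = {x \<in> space (bernoulli_nat q). \<forall>i\<in>{..<n}. x i \<in> {w ! i}}"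
  proof -
    have "map x [0..<n] = w \<longleftrightarrow> (\<forall>i<n. x i = w ! i)" for x
      using assms list_eq_iff_nth_eq[of "map x [0..<n]" w] by simp
    then show ?thesis by auto
  qed
  then have "emeasure (bernoulli_nat q) {x. map x [0..<n] = w}
      = emeasure (bernoulli_nat q) {x \<in> space (bernoulli_nat q). \<forall>i\<in>{..<n}. x i \<in> {w ! i}}"
    by simp
  also have "\<dots> = (\<Prod>i<n. emeasure (measure_pmf q) {w ! i})"
    unfolding bernoulli_nat_def by (rule emeasure_PiM_Collect) auto
  also have "\<dots> = ennreal (\<Prod>i<n. pmf q (w ! i))"
    by (simp add: emeasure_pmf_single prod_ennreal)
  also have "(\<Prod>i<n. pmf q (w ! i)) = prod_list (map (pmf q) w)"
    using assms by (simp add: prod.list_conv_set_nth atLeast0LessThan)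
  finally have eq: "emeasure (bernoulli_nat q) {x. map x [0..<n] = w} = ennreal (prod_list (map (pmf q) w))" .
  have "0 \<le> prod_list (map (pmf q) w)" by (rule prod_list_nonneg) auto
  then show ?thesis by (simp add: measure_def eq)
qed

lemma prob_prefix:
  fixes q :: "'s::finite pmf"
  shows "measure (bernoulli_nat q) {x. Q (map x [0..<n])}
    = (\<Sum>w | length w = n \<and> Q w. prod_list (map (pmf q) w))"
proof -
  interpret prob_space "bernoulli_nat q" by (rule prob_space_bernoulli_nat)
  have fin: "finite {w :: 's list. length w = n \<and> Q w}"
    by (rule finite_subset[OF _ finite_words[of n]]) auto
  have meas: "{x. map x [0..<n] = w} \<in> sets (bernoulli_nat q)" for w
    using measurable_sets[OF measurable_prefix[of n q], of "{w}"] by (simp add: vimage_def)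
  have "{x. Q (map x [0..<n])} = (\<Union>w\<in>{w. length w = n \<and> Q w}. {x. map x [0..<n] = w})"
    by auto
  then have "measure (bernoulli_nat q) {x. Q (map x [0..<n])}
      = (\<Sum>w | length w = n \<and> Q w. measure (bernoulli_nat q) {x. map x [0..<n] = w})"
    using fin meas by (simp only:) (intro finite_measure_finite_Union; auto simp: disjoint_family_on_def)
  then show ?thesis by (simp add: prob_prefix_eq)
qed

text \<open>Laziness allows words of different lengths to be padded to a common length.\<close>

definition lazy_weight :: "'s pmf \<Rightarrow> 's option \<Rightarrow> real" where
  "lazy_weight q = case_option (1 / 2) (\<lambda>i. pmf q i / 2)"

definition lazy_matrix :: "('s \<Rightarrow> real^2^2) \<Rightarrow> 's option \<Rightarrow> real^2^2" where
  "lazy_matrix A = case_option (mat 1) A"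

lemma sum_option: "(\<Sum>i\<in>UNIV. h i) = h None + (\<Sum>i\<in>UNIV. h (Some (i :: 's::finite)))"
  by (simp add: UNIV_option_conv sum.reindex)

lemma lazy_weight_nonneg: "0 \<le> lazy_weight q i"
  by (cases i) (auto simp: lazy_weight_def)

lemma sum_lazy_weight: "sum (lazy_weight (q :: 's::finite pmf)) UNIV = 1"
  using sum_pmf_eq_1[of UNIV q] by (simp add: sum_option lazy_weight_def flip: sum_divide_distrib)

lemma avg_lazy: "avg (lazy_weight q) (lazy_matrix A) f = (\<lambda>v. 1 / 2 * f v + 1 / 2 * avg (pmf q) A f v)"
  by (simp add: avg_def sum_option lazy_weight_def lazy_matrix_def sum_divide_distrib fun_eq_iff)

text \<open>The lazy operator is the mean of the identity and the Markov operator, so its powers are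
  convex combinations of iterates of the latter, and a common lower bound survives. The index
  \<open>j\<close> counts the genuine steps already taken, as the induction requires.\<close>

lemma funpow_avg_lazy_ge:
  assumes "\<And>K. K \<le> T \<Longrightarrow> c \<le> (avg (pmf q) A ^^ K) f v"
  shows "n + j \<le> T \<Longrightarrow> c \<le> (avg (lazy_weight q) (lazy_matrix A) ^^ n) ((avg (pmf q) A ^^ j) f) v"
proof (induction n arbitrary: j)
  case (Suc n)
  let ?R = "avg (lazy_weight q) (lazy_matrix A)" and ?h = "\<lambda>j. (avg (pmf q) A ^^ j) f"
  have "?R (?h j) = (\<lambda>v. 1 / 2 * ?h j v + 1 / 2 * ?h (Suc j) v)"
    by (simp add: avg_lazy)
  then have "(?R ^^ Suc n) (?h j) v = (?R ^^ n) (\<lambda>v. 1 / 2 * ?h j v + 1 / 2 * ?h (Suc j) v) v"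
    by (simp only: funpow_Suc_right comp_apply)
  also have "\<dots> = 1 / 2 * (?R ^^ n) (?h j) v + 1 / 2 * (?R ^^ n) (?h (Suc j)) v"
    unfolding funpow_avg[where p = "lazy_weight q"]
    by (simp only: distrib_left sum.distrib sum_distrib_left mult.left_commute)
  finally show ?case using Suc.IH[of j] Suc.IH[of "Suc j"] Suc.prems by simp
qed (use assms in simp)

text \<open>Two bounds for the squared norm of the lazy iterate of length \<open>m * k\<close>
  collide: at most \<open>c * (1 - p0) ^ k\<close> by contraction and, for large \<open>k\<close>,
  at least \<open>c * \<rho> ^ k / 4\<close> by the zero exponent, with \<rho> strictly between
  \<open>1 - p0\<close> and 1.\<close>

lemma zero_exponent_imp_bounded:
  fixes q :: "'s::finite pmf" and A :: "'s \<Rightarrow> real^2^2"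
  assumes SL2: "\<And>i. A i \<in> SL2" and irr: "strongly_irreducible (set_pmf q) A"
    and zero: "lyapunov_exponent q A = 0"
  shows "\<exists>C. \<forall>w\<in>lists (set_pmf q). op_norm (wprod A w) \<le> C"
proof (rule ccontr)
  assume "\<not> ?thesis"
  then have unbounded: "\<exists>w\<in>lists (set_pmf q). C < op_norm (wprod A w)" for C by (auto simp: not_le)
  obtain s :: "nat \<Rightarrow> 's list" and U V where s: "\<And>j. s j \<in> lists (set_pmf q)"
    and UV: "\<And>j. U j \<in> sets borel" "\<And>j. V j \<in> sets borel"
      "disjoint_family_on U {..<5::nat}" "disjoint_family_on V {..<5}"
      "\<And>j v. j < 5 \<Longrightarrow> v \<noteq> 0 \<Longrightarrow> v \<in> V j \<or> wprod A (s j) *v v \<in> U j"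
    and inj_s: "inj_on (\<lambda>j. wprod A (s j)) {..<5}"
    using ping_pong_words[OF irr _ unbounded] SL2 by metis
  \<comment> \<open>A common length for the five words; \<open>Suc\<close> keeps it positive, as
    \<epsilon> is defined by a division by \<open>m\<close>.\<close>
  define m where "m = Suc (\<Sum>j<5. length (s j))"
  have len: "length (s j) \<le> m" if "j < 5" for j
    using member_le_sum[of j "{..<5}" "\<lambda>j. length (s j)"] that by (simp add: m_def)
  define t where "t j = map Some (s j) @ replicate (m - length (s j)) None" for j
  let ?p = "lazy_weight q" and ?M = "lazy_matrix A"
  let ?R = "avg ?p ?M"
  have wprod_Some: "wprod ?M (map Some w) = wprod A w" for w
    by (induction w) (auto simp: lazy_matrix_def)
  have wprod_None: "wprod ?M (replicate n None) = mat 1" for n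
    by (induction n) (auto simp: lazy_matrix_def)
  have wprod_t: "wprod ?M (t j) = wprod A (s j)" for j
    by (simp add: t_def wprod_append wprod_Some wprod_None)
  have det_M: "det (wprod ?M w) = 1" for w
    using SL2 by (intro det_wprod) (auto simp: lazy_matrix_def SL2_def split: option.split)
  have inj_t: "inj_on t {..<5}"
    using inj_s by (auto simp: inj_on_def simp flip: wprod_t)
  \<comment> \<open>\<open>ping_pong_contraction\<close> is indexed by words, the ping-pong sets by
    numbers; \<iota> translates.\<close>
  define \<iota> where "\<iota> = the_inv_into {..<5} t"
  have \<iota>: "\<iota> (t j) = j" if "j < 5" for j
    unfolding \<iota>_def using inj_t that by (simp add: the_inv_into_f_f)
  have disj: "disjoint_family_on (\<lambda>w. F (\<iota> w)) (t ` {..<5})"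
    if "disjoint_family_on F {..<5}" for F :: "nat \<Rightarrow> (real^2) set"
    unfolding disjoint_family_on_def
  proof (intro ballI impI)
    fix w w' assume "w \<in> t ` {..<5}" "w' \<in> t ` {..<5}" "w \<noteq> w'"
    then obtain i j where "w = t i" "w' = t j" "i < 5" "j < 5" "i \<noteq> j" by auto
    then show "F (\<iota> w) \<inter> F (\<iota> w') = {}"
      using that by (auto simp: \<iota> disjoint_family_on_def)
  qed
  have weight_t: "0 < prod_list (map ?p (t j))" for j
  proof -
    have "0 < ?p i" if "i \<in> set (t j)" for i
      using that s[of j] by (auto simp: t_def lazy_weight_def pmf_positive_iff)
    moreover have "(\<And>i. i \<in> set w \<Longrightarrow> 0 < ?p i) \<Longrightarrow> 0 < prod_list (map ?p w)" for w
      by (induction w) auto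
    ultimately show ?thesis by blast
  qed
  define p0 where "p0 = Min ((\<lambda>j. prod_list (map ?p (t j))) ` {..<5::nat})"
  have p0: "0 < p0" unfolding p0_def using weight_t by (subst Min_gr_iff) (auto simp: lessThan_empty_iff)
  define I where "I f = (\<integral>\<^sup>+v. ennreal ((f v)\<^sup>2) \<partial>lborel)" for f :: "real^2 \<Rightarrow> real"
  have contraction: "I ((?R ^^ m) f) \<le> ennreal (1 - p0) * I f" if "f \<in> borel_measurable borel" for f
    unfolding I_def funpow_avg
  proof (rule ping_pong_contraction[where S = "t ` {..<5}" and U = "\<lambda>w. U (\<iota> w)" and V = "\<lambda>w. V (\<iota> w)"])
    show "t ` {..<5} \<subseteq> {w. length w = m}" using len by (auto simp: t_def)
    show "card (t ` {..<5}) = 5" using inj_t by (simp add: card_image)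
    show "p0 \<le> prod_list (map ?p w)" if "w \<in> t ` {..<5}" for w
      using that unfolding p0_def by (intro Min_le) auto
    show "0 \<le> prod_list (map ?p w)" for w
      by (intro prod_list_nonneg) (auto simp: lazy_weight_nonneg)
    show "(\<Sum>w | length w = m. prod_list (map ?p w)) = 1"
      by (rule sum_prod_list) (rule sum_lazy_weight)
    show "disjoint_family_on (\<lambda>w. U (\<iota> w)) (t ` {..<5})" "disjoint_family_on (\<lambda>w. V (\<iota> w)) (t ` {..<5})"
      by (rule disj[OF UV(3)] disj[OF UV(4)])+
    show "v \<in> V (\<iota> w) \<or> wprod ?M w *v v \<in> U (\<iota> w)" if w: "w \<in> t ` {..<5}" "v \<noteq> 0" for w v
    proof -
      obtain j where "w = t j" "j < 5" using w by auto
      then show ?thesis using UV(5)[of j v] w \<iota>[of j] wprod_t[of j] by simp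
    qed
  qed (use p0 UV that det_M in \<open>auto simp: finite_words\<close>)
  have p0_le: "p0 \<le> 1"
  proof -
    have "p0 \<le> prod_list (map ?p (t 0))" unfolding p0_def by (intro Min_le) auto
    also have "\<dots> \<le> (\<Sum>w | length w = m. prod_list (map ?p w))"
      by (rule member_le_sum) (use len[of 0] in \<open>auto simp: t_def finite_words intro!: prod_list_nonneg lazy_weight_nonneg\<close>)
    also have "\<dots> = 1" by (rule sum_prod_list) (rule sum_lazy_weight)
    finally show ?thesis .
  qed
  define f0 :: "real^2 \<Rightarrow> real" where "f0 = indicator (cball 0 1)"
  have f0_meas: "f0 \<in> borel_measurable borel" unfolding f0_def by (rule borel_measurable_indicator) simp
  have upper: "I ((?R ^^ (m * k)) f0) \<le> ennreal ((1 - p0) ^ k) * I f0" for k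
  proof (induction k)
    case (Suc k)
    have "I ((?R ^^ (m * Suc k)) f0) = I ((?R ^^ m) ((?R ^^ (m * k)) f0))"
      by (simp add: funpow_add)
    also have "\<dots> \<le> ennreal (1 - p0) * I ((?R ^^ (m * k)) f0)"
      by (intro contraction measurable_funpow_avg f0_meas)
    also have "\<dots> \<le> ennreal (1 - p0) * (ennreal ((1 - p0) ^ k) * I f0)"
      by (intro mult_left_mono Suc) auto
    also have "\<dots> = ennreal ((1 - p0) ^ Suc k) * I f0"
      using p0_le by (simp add: ennreal_mult mult.assoc)
    finally show ?case .
  qed simp
  define c where "c = unit_ball_vol (real DIM(real^2))"
  have c: "0 < c" by (simp add: c_def unit_ball_vol_pos)
  have I_ball: "I (indicator (cball 0 r)) = ennreal (c * r\<^sup>2)" if "0 \<le> r" for r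
  proof -
    have "I (indicator (cball 0 r)) = (\<integral>\<^sup>+v. indicator (cball (0::real^2) r) v \<partial>lborel)"
      unfolding I_def by (intro nn_integral_cong) (auto split: split_indicator)
    also have "\<dots> = ennreal (c * r\<^sup>2)" using that emeasure_cball[of r "0::real^2"] by (simp add: c_def)
    finally show ?thesis .
  qed
  obtain \<rho> where \<rho>: "1 - p0 < \<rho>" "\<rho> < 1" using dense[of "1 - p0" 1] p0 by auto
  then have \<rho>_pos: "0 < \<rho>" using p0_le by linarith
  \<comment> \<open>Chosen so that the disc of radius \<open>exp (- \<epsilon> * (m * k))\<close>
    has area \<open>c * \<rho> ^ k\<close>.\<close>
  define \<epsilon> where "\<epsilon> = - ln \<rho> / (2 * real m)"
  have m_pos: "0 < m" by (simp add: m_def)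
  have \<epsilon>: "0 < \<epsilon>" using \<rho> \<rho>_pos m_pos by (simp add: \<epsilon>_def field_simps ln_less_zero)
  interpret prob_space "bernoulli_nat q" by (rule prob_space_bernoulli_nat)
  let ?W = "\<lambda>x K. wprod A (map x [0..<K])"
  \<comment> \<open>All \<open>K \<le> n\<close> at once, with a bound depending on \<open>n\<close>
    alone: a lazy walk of length \<open>n\<close> makes an unknown number \<open>K\<close> of
    genuine steps.\<close>
  define E where "E n = {x. \<forall>K\<le>n. op_norm (?W x K) \<le> exp (\<epsilon> * real n)}" for n
  have E_prefix: "{x. op_norm (?W x K) \<le> b} \<in> events" for K b
    using measurable_sets[OF measurable_prefix[of K q], of "{w. op_norm (wprod A w) \<le> b}"]
    by (simp add: vimage_def)
  have E_meas: "E n \<in> events" for n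
  proof -
    have "E n = (\<Inter>K\<in>{..n}. {x. op_norm (?W x K) \<le> exp (\<epsilon> * real n)})" by (auto simp: E_def)
    then show ?thesis using E_prefix by (auto intro!: sets.finite_INT)
  qed
  have AE_E: "AE x in bernoulli_nat q. \<forall>\<^sub>F n in sequentially. x \<in> E n"
    using lyapunov_exponent_AE[of A q, OF SL2] unfolding zero
  proof eventually_elim
    case (elim x)
    let ?a = "\<lambda>K. ln (op_norm (?W x K))"
    have ge1: "1 \<le> op_norm (?W x K)" for K
      using SL2 by (intro op_norm_ge_1 det_wprod)
    have "\<forall>\<^sub>F K in sequentially. ?a K / real K < \<epsilon>"
      using elim \<epsilon> by (rule order_tendstoD)
    then obtain N where N: "\<And>K. K \<ge> N \<Longrightarrow> ?a K / real K < \<epsilon>" by (auto simp: eventually_sequentially)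
    define b where "b = (\<Sum>K\<le>N. ?a K)"
    have "\<forall>\<^sub>F n in sequentially. b / \<epsilon> \<le> real n"
      using filterlim_real_sequentially by (auto simp: filterlim_at_top)
    then show ?case
    proof eventually_elim
      case (elim n)
      have "?a K \<le> \<epsilon> * real n" if "K \<le> n" for K
      proof (cases "K \<le> N")
        case True
        then have "?a K \<le> b"
          unfolding b_def using ge1 by (intro member_le_sum) auto
        also have "\<dots> \<le> \<epsilon> * real n" using elim \<epsilon> by (simp add: field_simps)
        finally show ?thesis .
      next
        case False
        then have "?a K \<le> \<epsilon> * real K" using N[of K] by (simp add: field_simps)
        also have "\<dots> \<le> \<epsilon> * real n" using \<epsilon> that by (intro mult_left_mono) auto
        finally show ?thesis .
      qed
      then have "exp (?a K) \<le> exp (\<epsilon> * real n)" if "K \<le> n" for K using that by simp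
      moreover have "exp (?a K) = op_norm (?W x K)" for K using ge1[of K] by simp
      ultimately show ?case by (auto simp: E_def)
    qed
  qed
  obtain n0 where n0: "\<And>n. n0 \<le> n \<Longrightarrow> 1 / 2 \<le> prob (E n)"
  proof -
    \<comment> \<open>Almost sure eventual membership becomes a uniform bound through the increasing
      events \<open>F n\<close>, whose union has probability one.\<close>
    define F where "F n = (\<Inter>j\<in>{n..}. E j)" for n
    have F_meas: "F n \<in> events" for n unfolding F_def using E_meas by (auto intro!: sets.countable_INT')
    have "(\<lambda>n. prob (F n)) \<longlonglongrightarrow> prob (\<Union>n. F n)"
      using F_meas by (intro finite_Lim_measure_incseq) (auto simp: incseq_def F_def)
    moreover have "AE x in bernoulli_nat q. x \<in> (\<Union>n. F n)"
      using AE_E by eventually_elim (auto simp: F_def eventually_sequentially)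
    then have "prob (\<Union>n. F n) = 1"
      using F_meas by (intro prob_eq_1[THEN iffD2]) auto
    ultimately have "\<forall>\<^sub>F n in sequentially. 1 / 2 < prob (F n)"
      by (intro order_tendstoD) auto
    then obtain n0 where "1 / 2 < prob (F n0)" by (auto simp: eventually_sequentially)
    moreover have "prob (F n0) \<le> prob (E n)" if "n0 \<le> n" for n
      using that E_meas by (intro finite_measure_mono) (auto simp: F_def)
    ultimately have "1 / 2 \<le> prob (E n)" if "n0 \<le> n" for n using that by (meson less_imp_le order_trans)
    then show ?thesis by (rule that)
  qed
  \<comment> \<open>Every product of norm at most \<open>exp (\<epsilon> * n)\<close> carries this
    small disc into the unit disc, and such products have at least half of the probability.\<close>
  have walk_ge: "1 / 2 \<le> (avg (pmf q) A ^^ K) f0 v"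
    if "n0 \<le> n" "K \<le> n" "norm v \<le> exp (- \<epsilon> * real n)" for n K v
  proof -
    let ?Q = "\<lambda>w. op_norm (wprod A w) \<le> exp (\<epsilon> * real n)"
    have "1 / 2 \<le> prob (E n)" using n0 that by simp
    also have "\<dots> \<le> prob {x. ?Q (map x [0..<K])}"
      using that E_prefix by (intro finite_measure_mono) (auto simp: E_def)
    also have "\<dots> = (\<Sum>w | length w = K \<and> ?Q w. prod_list (map (pmf q) w))"
      by (rule prob_prefix)
    also have "\<dots> \<le> (\<Sum>w | length w = K \<and> ?Q w. prod_list (map (pmf q) w) * f0 (wprod A w *v v))"
    proof (rule sum_mono)
      fix w assume "w \<in> {w. length w = K \<and> ?Q w}"
      then have "norm (wprod A w *v v) \<le> exp (\<epsilon> * real n) * exp (- \<epsilon> * real n)"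
        using that by (intro order_trans[OF norm_mult_op_norm] mult_mono) auto
      then show "prod_list (map (pmf q) w) \<le> prod_list (map (pmf q) w) * f0 (wprod A w *v v)"
        by (simp add: f0_def flip: exp_add)
    qed
    also have "\<dots> \<le> (\<Sum>w | length w = K. prod_list (map (pmf q) w) * f0 (wprod A w *v v))"
      by (rule sum_mono2) (auto simp: finite_words f0_def intro!: mult_nonneg_nonneg prod_list_nonneg)
    finally show ?thesis by (simp add: funpow_avg)
  qed
  have lower: "ennreal (c * \<rho> ^ k / 4) \<le> I ((?R ^^ (m * k)) f0)" if "n0 \<le> m * k" for k
  proof -
    let ?r = "exp (- \<epsilon> * real (m * k))"
    have "?r\<^sup>2 = exp (ln \<rho> * real k)"
      using m_pos by (simp add: \<epsilon>_def power2_eq_square field_simps flip: exp_add)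
    also have "\<dots> = \<rho> ^ k" using \<rho>_pos by (simp add: exp_of_nat2_mult)
    finally have r2: "?r\<^sup>2 = \<rho> ^ k" .
    have "ennreal (c * \<rho> ^ k / 4) = ennreal (1 / 4) * ennreal (c * ?r\<^sup>2)"
      unfolding r2 using c \<rho>_pos by (subst ennreal_mult[symmetric]) auto
    also have "\<dots> = ennreal (1 / 4) * I (indicator (cball 0 ?r))"
      by (subst I_ball) auto
    also have "\<dots> = (\<integral>\<^sup>+v. ennreal (1 / 4) * ennreal ((indicator (cball (0::real^2) ?r) v)\<^sup>2) \<partial>lborel)"
      unfolding I_def
      by (rule nn_integral_cmult[symmetric])
        (auto intro!: measurable_compose[OF _ measurable_ennreal] borel_measurable_power borel_measurable_indicator)
    also have "\<dots> \<le> I ((?R ^^ (m * k)) f0)"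
      unfolding I_def
    proof (rule nn_integral_mono)
      fix v :: "real^2"
      show "ennreal (1 / 4) * ennreal ((indicator (cball 0 ?r) v)\<^sup>2) \<le> ennreal (((?R ^^ (m * k)) f0 v)\<^sup>2)"
      proof (cases "v \<in> cball 0 ?r")
        case True
        then have "1 / 2 \<le> (?R ^^ (m * k)) ((avg (pmf q) A ^^ 0) f0) v"
          using that by (intro funpow_avg_lazy_ge[where T = "m * k"] walk_ge) auto
        then have "(1 / 2)\<^sup>2 \<le> ((?R ^^ (m * k)) f0 v)\<^sup>2" by (intro power_mono) auto
        then show ?thesis using True by (auto simp: power2_eq_square intro!: ennreal_leI)
      qed simp
    qed
    finally show ?thesis .
  qed
  have "(\<lambda>k. ((1 - p0) / \<rho>) ^ k) \<longlonglongrightarrow> 0"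
    using p0_le \<rho> \<rho>_pos by (intro LIMSEQ_realpow_zero) (auto simp: field_simps)
  then have "\<forall>\<^sub>F k in sequentially. ((1 - p0) / \<rho>) ^ k < 1 / 4"
    by (rule order_tendstoD) auto
  then have "\<forall>\<^sub>F k in sequentially. n0 \<le> k \<and> ((1 - p0) / \<rho>) ^ k < 1 / 4"
    using eventually_ge_at_top[of n0] by eventually_elim simp
  then obtain k where k: "n0 \<le> k" "((1 - p0) / \<rho>) ^ k < 1 / 4"
    using eventually_happens'[OF sequentially_bot] by blast
  have I_f0: "I f0 = ennreal c" unfolding f0_def using I_ball[of 1] by simp
  have "n0 \<le> m * k" using k(1) m_pos by (intro order_trans[OF k(1)]) simp
  from order_trans[OF lower[OF this] upper[of k]]
  have "ennreal (c * \<rho> ^ k / 4) \<le> ennreal ((1 - p0) ^ k * c)"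
    using c p0_le by (simp add: I_f0 ennreal_mult)
  then have "c * \<rho> ^ k / 4 \<le> (1 - p0) ^ k * c"
    using c p0_le by (subst (asm) ennreal_le_iff) auto
  then have "\<rho> ^ k / 4 \<le> (1 - p0) ^ k" using c by (simp add: mult.commute)
  then show False using k(2) \<rho>_pos by (simp add: power_divide field_simps)
qed

section \<open>Perturbed products\<close>

text \<open>Induction over the last letter \<open>i\<close>, expanding \<open>B i = A i + (B i - A i)\<close>; the prefix \<open>u\<close>
  absorbs the letter \<open>i\<close> in the first summand.\<close>

lemma op_norm_perturbed_product_le:
  assumes bound: "\<And>u. u \<in> lists S \<Longrightarrow> op_norm (wprod A u) \<le> K"
    and \<delta>: "\<And>i. op_norm (B i - A i) \<le> \<delta>" and w: "w \<in> lists S" and "0 \<le> K"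
  shows "u \<in> lists S \<Longrightarrow> op_norm (wprod A u ** wprod B w) \<le> K * (1 + K * \<delta>) ^ length w"
  using w
proof (induction w arbitrary: u rule: rev_induct)
  case Nil
  then show ?case using bound by simp
next
  case (snoc i w)
  have \<delta>_nonneg: "0 \<le> \<delta>" using \<delta> op_norm_nonneg order_trans by blast
  let ?X = "wprod B w" and ?b = "K * (1 + K * \<delta>) ^ length w"
  have w: "w \<in> lists S" "i \<in> S" using snoc.prems by auto
  have X: "op_norm ?X \<le> ?b" using snoc.IH[of "[]"] w by simp
  have "op_norm (wprod A u ** wprod B (w @ [i])) \<le> ?b + K * (\<delta> * ?b)"
  proof (rule op_norm_leI)
    fix v
    have "(wprod A u ** wprod B (w @ [i])) *v v
        = (wprod A (i # u) ** ?X) *v v + wprod A u *v ((B i - A i) *v (?X *v v))"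
      by (simp add: wprod_append matrix_vector_mult_diff_rdistrib matrix_vector_mult_diff_distrib
          flip: matrix_vector_mul_assoc)
    also have "norm \<dots> \<le> ?b * norm v + K * (\<delta> * (?b * norm v))"
    proof (rule norm_triangle_mono)
      show "norm ((wprod A (i # u) ** ?X) *v v) \<le> ?b * norm v"
        using snoc.IH[of "i # u"] snoc.prems w
        by (intro order_trans[OF norm_mult_op_norm] mult_right_mono) auto
      show "norm (wprod A u *v ((B i - A i) *v (?X *v v))) \<le> K * (\<delta> * (?b * norm v))"
        using bound[OF snoc.prems(1)] \<delta> X \<open>0 \<le> K\<close> \<delta>_nonneg
        by (intro order_trans[OF norm_mult_op_norm] mult_mono order_trans[OF norm_mult_op_norm[of "B i - A i"]]
            order_trans[OF norm_mult_op_norm[of ?X]]) auto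
    qed
    finally show "norm ((wprod A u ** wprod B (w @ [i])) *v v) \<le> (?b + K * (\<delta> * ?b)) * norm v"
      by (simp add: algebra_simps)
  qed (use \<open>0 \<le> K\<close> \<delta>_nonneg in auto)
  then show ?case by (simp add: algebra_simps)
qed

theorem proposition11:
  fixes q :: "'s::finite pmf" and A :: "'s \<Rightarrow> real^2^2"
  assumes "\<And>i. A i \<in> SL2"
    and "strongly_irreducible (set_pmf q) A"
    and "lyapunov_exponent q A = 0"
  shows "\<exists>C::real. \<forall>B :: 's \<Rightarrow> real^2^2. (\<forall>i. B i \<in> SL2) \<longrightarrow>
           \<bar>lyapunov_exponent q A - lyapunov_exponent q B\<bar> \<le> C * sup_norm (\<lambda>i. A i - B i)"
proof -
  obtain K where K: "\<And>w. w \<in> lists (set_pmf q) \<Longrightarrow> op_norm (wprod A w) \<le> K"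
    using zero_exponent_imp_bounded[OF assms] by blast
  have K1: "1 \<le> K" using K[of "[]"] op_norm_ge_1[of "mat 1"] by simp
  have "\<bar>lyapunov_exponent q A - lyapunov_exponent q B\<bar> \<le> K * sup_norm (\<lambda>i. A i - B i)"
    if B: "\<And>i. B i \<in> SL2" for B
  proof -
    interpret prob_space "bernoulli_nat q" by (rule prob_space_bernoulli_nat)
    define \<delta> where "\<delta> = sup_norm (\<lambda>i. A i - B i)"
    have \<delta>: "op_norm (B i - A i) \<le> \<delta>" for i
    proof -
      have "op_norm (B i - A i) \<le> op_norm (A i - B i)"
      proof (rule op_norm_leI)
        fix v
        have "norm ((B i - A i) *v v) = norm ((A i - B i) *v v)"
          by (simp add: matrix_vector_mult_diff_rdistrib norm_minus_commute)
        then show "norm ((B i - A i) *v v) \<le> op_norm (A i - B i) * norm v"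
          using norm_mult_op_norm by metis
      qed simp
      also have "\<dots> \<le> \<delta>" unfolding \<delta>_def sup_norm_def by (intro Max_ge) auto
      finally show ?thesis .
    qed
    have \<delta>_nonneg: "0 \<le> \<delta>" using \<delta> op_norm_nonneg order_trans by blast
    \<comment> \<open>The bound \<open>K\<close> concerns words over the support of \<open>q\<close>
      only. Almost every sequence stays in the support, so a single sequence \<open>x\<close> can be
      chosen that does so and realises the exponent of \<open>B\<close>.\<close>
    have "AE x in bernoulli_nat q. \<forall>n. x n \<in> set_pmf q"
      unfolding AE_all_countable bernoulli_nat_def
      by (intro allI AE_PiM_component) (auto intro: measure_pmf.prob_space_axioms AE_pmfI)
    with lyapunov_exponent_AE[of B q, OF B]
    have "AE x in bernoulli_nat q. \<exists>x. (\<forall>n. x n \<in> set_pmf q) \<and>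
        (\<lambda>n. ln (op_norm (wprod B (map x [0..<n]))) / real n) \<longlonglongrightarrow> lyapunov_exponent q B"
      by eventually_elim blast
    then obtain x where x: "\<And>n. x n \<in> set_pmf q"
      and lim: "(\<lambda>n. ln (op_norm (wprod B (map x [0..<n]))) / real n) \<longlonglongrightarrow> lyapunov_exponent q B"
      by auto
    have ge1: "1 \<le> op_norm (wprod B (map x [0..<n]))" for n
      using B by (intro op_norm_ge_1 det_wprod)
    have "0 \<le> lyapunov_exponent q B"
      using ge1 by (intro LIMSEQ_le_const[OF lim] exI[of _ 0] allI impI divide_nonneg_nonneg) auto
    \<comment> \<open>The prefactor \<open>K\<close> contributes only \<open>ln K / n\<close>, and
      \<open>1 + K * \<delta> \<le> exp (K * \<delta>)\<close> makes the rate linear in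
      \<delta>.\<close>
    moreover have "lyapunov_exponent q B \<le> K * \<delta>"
    proof (rule LIMSEQ_le[OF lim])
      show "(\<lambda>n. ln K / real n + K * \<delta>) \<longlonglongrightarrow> K * \<delta>"
        using tendsto_add[OF lim_const_over_n[of "ln K"] tendsto_const[of "K * \<delta>"]] by simp
      show "\<exists>N. \<forall>n\<ge>N. ln (op_norm (wprod B (map x [0..<n]))) / real n \<le> ln K / real n + K * \<delta>"
      proof (intro exI[of _ 1] allI impI)
        fix n :: nat assume n: "1 \<le> n"
        have "map x [0..<n] \<in> lists (set_pmf q)" using x by auto
        then have "op_norm (wprod B (map x [0..<n])) \<le> K * (1 + K * \<delta>) ^ n"
          using op_norm_perturbed_product_le[of "set_pmf q" A K B \<delta> "map x [0..<n]" "[]"] K \<delta> K1 x by auto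
        also have "\<dots> \<le> K * exp (K * \<delta>) ^ n"
          using K1 \<delta>_nonneg by (intro mult_left_mono power_mono exp_ge_add_one_self) auto
        finally have "ln (op_norm (wprod B (map x [0..<n]))) \<le> ln (K * exp (K * \<delta>) ^ n)"
          using ge1[of n] K1 by (intro ln_mono) auto
        also have "\<dots> = ln K + real n * (K * \<delta>)" using K1 by (simp add: ln_mult ln_realpow)
        finally show "ln (op_norm (wprod B (map x [0..<n]))) / real n \<le> ln K / real n + K * \<delta>"
          using n by (simp add: field_simps)
      qed
    qed
    ultimately show ?thesis using assms(3) by (simp add: \<delta>_def)
  qed
  then show ?thesis by blast
qed

end
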